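(* Let $n\ge 2$. The variety $\mathbf{V(C_n^{dp})}$ is defined, modulo $\mathbf{JIDL_1}$, by the two identities (1) $x\vee x'\approx 1$, (2) $x_1\vee x_2\vee\cdots\vee x_n\vee(x_1\to x_2)\vee(x_2\to x_3)\vee\cdots\vee(x_{n-1}\to x_n)\approx 1$; that is, it is exactly the class of algebras in $\mathbf{JIDL_1}$ satisfying (1) and (2).
   Context: A semi-Heyting algebra is an algebra $\langle L,\vee,\wedge,\to,0,1\rangle$ such that $\langle L,\vee,\wedge,0,1\rangle$ is a bounded lattice and the identities $x\wedge(x\to y)\approx x\wedge y$, $x\wedge(y\to z)\approx x\wedge[(x\wedge y)\to(x\wedge z)]$, $x\to x\approx 1$ hold; it is a Heyting algebra if moreover $(x\wedge y)\to y\approx 1$. Write $x^*:=x\to 0$. A $\mathbf{DQD}$-algebra (dually quasi-De Morgan semi-Heyting algebra) is an algebra $\langle L,\vee,\wedge,\to,{}',0,1\rangle$ whose reduct $\langle L,\vee,\wedge,\to,0,1\rangle$ is a semi-Heyting algebra and which satisfies: $0'\approx 1$ and $1'\approx 0$; $(x\wedge y)'\approx x'\vee y'$; $(x\vee y)''\approx x''\vee y''$; $x''\le x$. $\mathbf{DQD}$ denotes the variety of all $\mathbf{DQD}$-algebras. $\mathbf{JIDL_1}$ is the subvariety of $\mathbf{DQD}$ defined by the identities $x'\vee(y\to z)\approx(x'\vee y)\to(x'\vee z)$, $(x\to y)\vee(y\to x)\approx 1$, and $x\wedge x'^{*}\approx (x\wedge x'^{*})'^{*}$ (where $z'^*$ means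 $(z')^*$); in the presence of the first identity, the last is equivalent to the level-1 identity $x\wedge x'^*\approx x\wedge x'^*\wedge x'^*{}'^*$. A dually Stone Heyting chain is a $\mathbf{DQD}$-algebra satisfying $x'\wedge x''\approx 0$ whose semi-Heyting reduct is a Heyting algebra and whose lattice reduct is a chain; $\mathbf{C_n^{dp}}$ is the (unique up to isomorphism) $n$-element dually Stone Heyting chain, and $\mathbf{V(C_n^{dp})}$ is the variety it generates. *)

theory Defs
  imports "HOL-Library.FuncSet"
begin

record 'a dqd_algebra =
  carrier :: "'a set"
  join :: "'a \<Rightarrow> 'a \<Rightarrow> 'a" (infixl \<open>\<squnion>\<index>\<close> 65)
  meet :: "'a \<Rightarrow> 'a \<Rightarrow> 'a" (infixl \<open>\<sqinter>\<index>\<close> 70)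
  imp :: "'a \<Rightarrow> 'a \<Rightarrow> 'a" (infixr \<open>\<rightharpoonup>\<index>\<close> 60)
  dneg :: "'a \<Rightarrow> 'a" (\<open>\<sim>\<index> _\<close> [81] 80)
  zero_elt :: "'a" (\<open>\<zero>\<index>\<close>)
  one_elt :: "'a" (\<open>\<one>\<index>\<close>)

text \<open>
  The unary operation written as a postfix prime in the literature is the prefix \<open>\<sim>\<close> here, and
  the pseudocomplement \<open>x \<rightharpoonup> \<zero>\<close> is \<^emph>\<open>star\<close>; thus \<open>x'\<^sup>*\<close> is \<open>star L (\<sim> x)\<close>.
\<close>

definition star :: "'a dqd_algebra \<Rightarrow> 'a \<Rightarrow> 'a" where
  "star L x = x \<rightharpoonup>\<^bsub>L\<^esub> \<zero>\<^bsub>L\<^esub>"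

definition lat_le :: "'a dqd_algebra \<Rightarrow> 'a \<Rightarrow> 'a \<Rightarrow> bool" where
  "lat_le L x y \<longleftrightarrow> x \<sqinter>\<^bsub>L\<^esub> y = x"

locale semi_Heyting_algebra =
  fixes L :: "'a dqd_algebra" (structure)
  assumes join_closed: "\<lbrakk>x \<in> carrier L; y \<in> carrier L\<rbrakk> \<Longrightarrow> x \<squnion> y \<in> carrier L"
    and meet_closed: "\<lbrakk>x \<in> carrier L; y \<in> carrier L\<rbrakk> \<Longrightarrow> x \<sqinter> y \<in> carrier L"
    and imp_closed: "\<lbrakk>x \<in> carrier L; y \<in> carrier L\<rbrakk> \<Longrightarrow> x \<rightharpoonup> y \<in> carrier L"
    and zero_closed: "\<zero> \<in> carrier L"
    and one_closed: "\<one> \<in> carrier L"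
    and join_comm: "\<lbrakk>x \<in> carrier L; y \<in> carrier L\<rbrakk> \<Longrightarrow> x \<squnion> y = y \<squnion> x"
    and meet_comm: "\<lbrakk>x \<in> carrier L; y \<in> carrier L\<rbrakk> \<Longrightarrow> x \<sqinter> y = y \<sqinter> x"
    and join_assoc: "\<lbrakk>x \<in> carrier L; y \<in> carrier L; z \<in> carrier L\<rbrakk>
          \<Longrightarrow> (x \<squnion> y) \<squnion> z = x \<squnion> (y \<squnion> z)"
    and meet_assoc: "\<lbrakk>x \<in> carrier L; y \<in> carrier L; z \<in> carrier L\<rbrakk>
          \<Longrightarrow> (x \<sqinter> y) \<sqinter> z = x \<sqinter> (y \<sqinter> z)"
    and join_absorb: "\<lbrakk>x \<in> carrier L; y \<in> carrier L\<rbrakk> \<Longrightarrow> x \<squnion> (x \<sqinter> y) = x"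
    and meet_absorb: "\<lbrakk>x \<in> carrier L; y \<in> carrier L\<rbrakk> \<Longrightarrow> x \<sqinter> (x \<squnion> y) = x"
    and meet_zero: "x \<in> carrier L \<Longrightarrow> x \<sqinter> \<zero> = \<zero>"
    and join_one: "x \<in> carrier L \<Longrightarrow> x \<squnion> \<one> = \<one>"
    and meet_imp: "\<lbrakk>x \<in> carrier L; y \<in> carrier L\<rbrakk> \<Longrightarrow> x \<sqinter> (x \<rightharpoonup> y) = x \<sqinter> y"
    and meet_imp_meet: "\<lbrakk>x \<in> carrier L; y \<in> carrier L; z \<in> carrier L\<rbrakk>
          \<Longrightarrow> x \<sqinter> (y \<rightharpoonup> z) = x \<sqinter> ((x \<sqinter> y) \<rightharpoonup> (x \<sqinter> z))"
    and imp_self: "x \<in> carrier L \<Longrightarrow> x \<rightharpoonup> x = \<one>"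

locale Heyting_algebra = semi_Heyting_algebra +
  assumes meet_imp_one: "\<lbrakk>x \<in> carrier L; y \<in> carrier L\<rbrakk> \<Longrightarrow> (x \<sqinter> y) \<rightharpoonup> y = \<one>"

locale DQD = semi_Heyting_algebra +
  assumes dneg_closed: "x \<in> carrier L \<Longrightarrow> \<sim> x \<in> carrier L"
    and dneg_zero: "\<sim> \<zero> = \<one>"
    and dneg_one: "\<sim> \<one> = \<zero>"
    and dneg_meet: "\<lbrakk>x \<in> carrier L; y \<in> carrier L\<rbrakk> \<Longrightarrow> \<sim> (x \<sqinter> y) = \<sim> x \<squnion> \<sim> y"
    and dneg_dneg_join: "\<lbrakk>x \<in> carrier L; y \<in> carrier L\<rbrakk>
          \<Longrightarrow> \<sim> (\<sim> (x \<squnion> y)) = \<sim> (\<sim> x) \<squnion> \<sim> (\<sim> y)"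
    and dneg_dneg_le: "x \<in> carrier L \<Longrightarrow> lat_le L (\<sim> (\<sim> x)) x"

locale JIDL1 = DQD +
  assumes dneg_join_imp: "\<lbrakk>x \<in> carrier L; y \<in> carrier L; z \<in> carrier L\<rbrakk>
          \<Longrightarrow> \<sim> x \<squnion> (y \<rightharpoonup> z) = (\<sim> x \<squnion> y) \<rightharpoonup> (\<sim> x \<squnion> z)"
    and prelinear: "\<lbrakk>x \<in> carrier L; y \<in> carrier L\<rbrakk> \<Longrightarrow> (x \<rightharpoonup> y) \<squnion> (y \<rightharpoonup> x) = \<one>"
    and level_one: "x \<in> carrier L
          \<Longrightarrow> x \<sqinter> star L (\<sim> x) = star L (\<sim> (x \<sqinter> star L (\<sim> x)))"

locale dually_Stone_Heyting_chain = DQD + Heyting_algebra +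
  assumes dually_Stone: "x \<in> carrier L \<Longrightarrow> \<sim> x \<sqinter> \<sim> (\<sim> x) = \<zero>"
    and chain: "\<lbrakk>x \<in> carrier L; y \<in> carrier L\<rbrakk> \<Longrightarrow> lat_le L x y \<or> lat_le L y x"

text \<open>Every finite size \<open>n \<ge> 1\<close> is attained by a dually Stone Heyting chain.\<close>

lemma dually_Stone_Heyting_chain_exists:
  assumes "n \<ge> 1"
  shows "\<exists>C :: nat dqd_algebra. dually_Stone_Heyting_chain C \<and> card (carrier C) = n"
proof -
  define C :: "nat dqd_algebra" where "C =
    \<lparr> carrier = {0..<n}, join = max, meet = min,
      imp = (\<lambda>i j. if i \<le> j then n - 1 else j),
      dneg = (\<lambda>i. if i = n - 1 then 0 else n - 1),
      zero_elt = 0, one_elt = n - 1 \<rparr>"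
  have "dually_Stone_Heyting_chain C"
    unfolding C_def using assms
    apply unfold_locales
    apply (simp_all add: lat_le_def ac_simps max.absorb1 min.absorb1 max.absorb2 min.absorb2)
    subgoal for x y z by (cases "x \<le> y") auto
    subgoal for x y by (cases "x \<le> y") auto
    subgoal for x y by (cases "x \<le> y") auto
    done
  moreover have "card (carrier C) = n" by (simp add: C_def)
  ultimately show ?thesis by blast
qed

definition dqd_hom :: "'a set \<Rightarrow> 'a dqd_algebra \<Rightarrow> 'b dqd_algebra \<Rightarrow> ('a \<Rightarrow> 'b) \<Rightarrow> bool" where
  "dqd_hom S B A h \<longleftrightarrow> h ` S \<subseteq> carrier A
     \<and> (\<forall>x\<in>S. \<forall>y\<in>S. h (x \<squnion>\<^bsub>B\<^esub> y) = h x \<squnion>\<^bsub>A\<^esub> h y)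
     \<and> (\<forall>x\<in>S. \<forall>y\<in>S. h (x \<sqinter>\<^bsub>B\<^esub> y) = h x \<sqinter>\<^bsub>A\<^esub> h y)
     \<and> (\<forall>x\<in>S. \<forall>y\<in>S. h (x \<rightharpoonup>\<^bsub>B\<^esub> y) = h x \<rightharpoonup>\<^bsub>A\<^esub> h y)
     \<and> (\<forall>x\<in>S. h (\<sim>\<^bsub>B\<^esub> x) = \<sim>\<^bsub>A\<^esub> (h x))
     \<and> h \<zero>\<^bsub>B\<^esub> = \<zero>\<^bsub>A\<^esub> \<and> h \<one>\<^bsub>B\<^esub> = \<one>\<^bsub>A\<^esub>"

definition dqd_subuniverse :: "'a set \<Rightarrow> 'a dqd_algebra \<Rightarrow> bool" where
  "dqd_subuniverse S B \<longleftrightarrow> S \<subseteq> carrier B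
     \<and> (\<forall>x\<in>S. \<forall>y\<in>S. x \<squnion>\<^bsub>B\<^esub> y \<in> S \<and> x \<sqinter>\<^bsub>B\<^esub> y \<in> S \<and> x \<rightharpoonup>\<^bsub>B\<^esub> y \<in> S)
     \<and> (\<forall>x\<in>S. \<sim>\<^bsub>B\<^esub> x \<in> S) \<and> \<zero>\<^bsub>B\<^esub> \<in> S \<and> \<one>\<^bsub>B\<^esub> \<in> S"

definition power_algebra :: "'i set \<Rightarrow> 'c dqd_algebra \<Rightarrow> ('i \<Rightarrow> 'c) dqd_algebra" where
  "power_algebra I C =
    \<lparr> carrier = I \<rightarrow>\<^sub>E carrier C,
      join = (\<lambda>f g. \<lambda>i\<in>I. f i \<squnion>\<^bsub>C\<^esub> g i),
      meet = (\<lambda>f g. \<lambda>i\<in>I. f i \<sqinter>\<^bsub>C\<^esub> g i),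
      imp = (\<lambda>f g. \<lambda>i\<in>I. f i \<rightharpoonup>\<^bsub>C\<^esub> g i),
      dneg = (\<lambda>f. \<lambda>i\<in>I. \<sim>\<^bsub>C\<^esub> (f i)),
      zero_elt = (\<lambda>i\<in>I. \<zero>\<^bsub>C\<^esub>),
      one_elt = (\<lambda>i\<in>I. \<one>\<^bsub>C\<^esub>) \<rparr>"

definition HSP_over :: "'i set \<Rightarrow> 'c dqd_algebra \<Rightarrow> 'a dqd_algebra \<Rightarrow> bool" where
  "HSP_over I C A \<longleftrightarrow> (\<exists>S h. dqd_subuniverse S (power_algebra I C)
     \<and> dqd_hom S (power_algebra I C) A h \<and> h ` S = carrier A)"

text \<open>
  The variety generated by a single algebra \<open>C\<close>, taken as \<open>HSP(C)\<close> (Tarski). HOL cannot quantify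
  over the type of the index set inside a definition, so index sets of type
  \<open>('a \<Rightarrow> 'c) set\<close> are used; this loses nothing, since by \<open>HSP_over_imp_variety\<close> below a
  representation with an index set of any other type can be replaced by one of this type.
\<close>

definition variety_generated :: "'c dqd_algebra \<Rightarrow> 'a dqd_algebra set" where
  "variety_generated C = {A. \<exists>I :: ('a \<Rightarrow> 'c) set. HSP_over I C A}"

lemma HSP_over_imp_variety:
  fixes I :: "'i set" and C :: "'c dqd_algebra" and A :: "'a dqd_algebra"
  assumes "HSP_over I C A"
  shows "A \<in> variety_generated C"
proof -
  obtain S h where S: "dqd_subuniverse S (power_algebra I C)"
    and h: "dqd_hom S (power_algebra I C) A h" and surj: "h ` S = carrier A"
    using assms unfolding HSP_over_def by auto
  define s where "s = (\<lambda>a. SOME x. x \<in> S \<and> h x = a)"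
  have s: "s a \<in> S \<and> h (s a) = a" if "a \<in> carrier A" for a
  proof -
    have "a \<in> h ` S" using that by (simp only: surj)
    then have "\<exists>x. x \<in> S \<and> h x = a" by auto
    from someI_ex[OF this] show ?thesis by (simp add: s_def)
  qed
  define r where "r = (\<lambda>i. \<lambda>a\<in>carrier A. s a i)"
  define J where "J = r ` I"
  define P where "P = (\<lambda>u :: ('a \<Rightarrow> 'c) \<Rightarrow> 'c. \<lambda>i\<in>I. u (r i))"
  define T where "T = {u \<in> J \<rightarrow>\<^sub>E carrier C. P u \<in> S}"
  have rJ: "r i \<in> J" if "i \<in> I" for i using that by (simp add: J_def)
  have S_sub: "S \<subseteq> I \<rightarrow>\<^sub>E carrier C"
    using S by (simp add: dqd_subuniverse_def power_algebra_def)
  let ?B = "power_algebra I C" and ?D = "power_algebra J C"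
  have P_join: "P (u \<squnion>\<^bsub>?D\<^esub> v) = P u \<squnion>\<^bsub>?B\<^esub> P v"
    and P_meet: "P (u \<sqinter>\<^bsub>?D\<^esub> v) = P u \<sqinter>\<^bsub>?B\<^esub> P v"
    and P_imp: "P (u \<rightharpoonup>\<^bsub>?D\<^esub> v) = P u \<rightharpoonup>\<^bsub>?B\<^esub> P v"
    and P_dneg: "P (\<sim>\<^bsub>?D\<^esub> u) = \<sim>\<^bsub>?B\<^esub> (P u)"
    and P_zero: "P \<zero>\<^bsub>?D\<^esub> = \<zero>\<^bsub>?B\<^esub>" and P_one: "P \<one>\<^bsub>?D\<^esub> = \<one>\<^bsub>?B\<^esub>" for u v
    by (auto simp: P_def power_algebra_def rJ fun_eq_iff restrict_def)
  note P_simps = P_join P_meet P_imp P_dneg P_zero P_one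
  have S_closed: "x \<squnion>\<^bsub>?B\<^esub> y \<in> S" "x \<sqinter>\<^bsub>?B\<^esub> y \<in> S" "x \<rightharpoonup>\<^bsub>?B\<^esub> y \<in> S"
    if "x \<in> S" "y \<in> S" for x y
    using S that by (simp_all add: dqd_subuniverse_def)
  have S_dneg: "\<sim>\<^bsub>?B\<^esub> x \<in> S" if "x \<in> S" for x
    using S that by (simp add: dqd_subuniverse_def)
  have S_const: "\<zero>\<^bsub>?B\<^esub> \<in> S" "\<one>\<^bsub>?B\<^esub> \<in> S"
    using S by (simp_all add: dqd_subuniverse_def)
  have closed: "x \<in> carrier C" if "f \<in> S" "i \<in> I" "x = f i" for f i x
    using that S_sub by auto
  have inD: "u \<in> J \<rightarrow>\<^sub>E carrier C" if "u \<in> extensional J" "P u \<in> S" for u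
  proof (rule PiE_I)
    fix j assume "j \<in> J"
    then obtain i where i: "i \<in> I" "j = r i" by (auto simp: J_def)
    then have "u j = P u i" by (simp add: P_def)
    then show "u j \<in> carrier C" using closed that i by blast
  qed (use that in \<open>auto simp: extensional_def\<close>)
  have D_ext: "u \<squnion>\<^bsub>?D\<^esub> v \<in> extensional J" "u \<sqinter>\<^bsub>?D\<^esub> v \<in> extensional J"
    "u \<rightharpoonup>\<^bsub>?D\<^esub> v \<in> extensional J" "\<sim>\<^bsub>?D\<^esub> u \<in> extensional J"
    "\<zero>\<^bsub>?D\<^esub> \<in> extensional J" "\<one>\<^bsub>?D\<^esub> \<in> extensional J" for u v
    by (simp_all add: power_algebra_def)
  have T_I: "u \<in> T" if "u \<in> extensional J" "P u \<in> S" for u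
    unfolding T_def using inD[OF that] that(2) by blast
  have T_D: "P u \<in> S" if "u \<in> T" for u using that by (simp add: T_def)
  have T: "dqd_subuniverse T ?D"
    unfolding dqd_subuniverse_def
  proof (intro conjI ballI)
    show "T \<subseteq> carrier ?D" by (auto simp: T_def power_algebra_def)
  qed (rule T_I, rule D_ext, simp add: P_simps S_closed S_dneg S_const T_D)+
  have hom: "dqd_hom T ?D A (h \<circ> P)"
    unfolding dqd_hom_def
  proof (intro conjI ballI)
    show "(h \<circ> P) ` T \<subseteq> carrier A" using T_D surj by auto
  qed (use h T_D in \<open>simp_all add: dqd_hom_def P_simps\<close>)
  have "carrier A \<subseteq> (h \<circ> P) ` T"
  proof
    fix a assume a: "a \<in> carrier A"
    define u where "u = (\<lambda>f\<in>J. f a)"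
    have "P u i = s a i" for i
    proof (cases "i \<in> I")
      case True
      then show ?thesis using a rJ by (simp add: P_def u_def) (simp add: r_def)
    next
      case False
      moreover have "s a \<in> I \<rightarrow>\<^sub>E carrier C" using s[OF a] S_sub by blast
      ultimately show ?thesis by (auto simp: P_def PiE_def extensional_def)
    qed
    then have Pu: "P u = s a" by blast
    have "u \<in> extensional J" by (simp add: u_def)
    then have "u \<in> T" using s[OF a] by (intro T_I) (simp_all add: Pu)
    then have "(h \<circ> P) u \<in> (h \<circ> P) ` T" by (rule imageI)
    moreover have "(h \<circ> P) u = a" using s[OF a] by (simp add: Pu)
    ultimately show "a \<in> (h \<circ> P) ` T" by (simp only:)
  qed
  moreover have "(h \<circ> P) ` T \<subseteq> carrier A" using hom by (simp add: dqd_hom_def)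
  ultimately have "(h \<circ> P) ` T = carrier A" by (rule equalityI[rotated])
  then have "HSP_over J C A"
    unfolding HSP_over_def using T hom by (intro exI conjI)
  then show ?thesis unfolding variety_generated_def by (intro CollectI exI)
qed

text \<open>
  The join of a nonempty list, associated to the left (the value on the empty list is irrelevant).
\<close>

fun joins :: "'a dqd_algebra \<Rightarrow> 'a list \<Rightarrow> 'a" where
  "joins L [] = \<zero>\<^bsub>L\<^esub>"
| "joins L (x # xs) = foldl (join L) x xs"

end

theory Submission
  imports Defs
begin

text \<open>
  In an \<open>n\<close>-element dually Stone Heyting chain the arrow is determined by the order, and \<open>'\<close> sends
  \<open>1\<close> to \<open>0\<close> and every other element to \<open>1\<close>. The identities of \<open>JIDL\<^sub>1\<close>, \<open>x \<or> x' = 1\<close> and the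
  \<open>n\<close>-variable identity are then verified directly, and they pass to powers, subalgebras and
  homomorphic images.

  For the converse it suffices to separate any two elements \<open>a \<noteq> b\<close> of an algebra \<open>A\<close> satisfying the
  identities by a homomorphism into the chain \<open>C\<close>, since \<open>A\<close> then embeds into a power of \<open>C\<close>
  (\<open>HSP_over_if_separated\<close>). Prelinearity makes \<open>A\<close> a Heyting algebra (\<open>Heyting\<close>). Distributivity of
  \<open>x' \<or> _\<close> over the arrow makes every \<open>x'\<close> complemented, and with \<open>x \<or> x' = 1\<close> and the last identity
  of \<open>JIDL\<^sub>1\<close> one gets \<open>x'' = x'\<^sup>*\<close> (\<open>dneg_dneg_eq\<close>). Consequently, for a prime filter \<open>P\<close> of the
  lattice, \<open>F = {x. x'' \<in> P}\<close> is again a prime filter, and exactly one of \<open>x\<close>, \<open>x'\<close> lies in \<open>F\<close>.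
  Preordering \<open>A\<close> by \<open>x \<rightarrow> y \<in> F\<close> yields a quotient that is a Heyting chain, linear by prelinearity, with
  \<open>'\<close> acting as in \<open>C\<close>; hence any map into \<open>C\<close> that embeds this preorder and preserves \<open>0\<close> and \<open>1\<close> is a
  homomorphism (\<open>hom_of_quotient_embedding\<close>). The \<open>n\<close>-variable identity bounds the length of strictly
  descending sequences outside \<open>F\<close> (\<open>descending_bound\<close>), so the height function of the quotient
  provides such an embedding. Finally \<open>c = (a \<rightarrow> b) \<and> (b \<rightarrow> a)\<close> differs from \<open>1\<close>, so \<open>c'' \<le> c\<close> does as well,
  and choosing \<open>P\<close> to omit \<open>c''\<close> separates \<open>a\<close> from \<open>b\<close>.
\<close>

section \<open>Semi-Heyting algebras as distributive lattices\<close>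

context semi_Heyting_algebra
begin

abbreviation le :: "'a \<Rightarrow> 'a \<Rightarrow> bool" (infix \<open>\<sqsubseteq>\<close> 50) where
  "x \<sqsubseteq> y \<equiv> lat_le L x y"

lemmas closed = join_closed meet_closed imp_closed zero_closed one_closed

lemma meet_idem: "x \<in> carrier L \<Longrightarrow> x \<sqinter> x = x"
  by (metis join_absorb meet_absorb meet_closed)

lemma join_idem: "x \<in> carrier L \<Longrightarrow> x \<squnion> x = x"
  by (metis join_absorb meet_idem)

lemma le_refl: "x \<in> carrier L \<Longrightarrow> x \<sqsubseteq> x"
  by (simp add: lat_le_def meet_idem)

lemma le_antisym: "\<lbrakk>x \<sqsubseteq> y; y \<sqsubseteq> x; x \<in> carrier L; y \<in> carrier L\<rbrakk> \<Longrightarrow> x = y"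
  by (metis lat_le_def meet_comm)

lemma le_trans:
  "\<lbrakk>x \<sqsubseteq> y; y \<sqsubseteq> z; x \<in> carrier L; y \<in> carrier L; z \<in> carrier L\<rbrakk> \<Longrightarrow> x \<sqsubseteq> z"
  by (metis lat_le_def meet_assoc)

lemma meet_le1: "\<lbrakk>x \<in> carrier L; y \<in> carrier L\<rbrakk> \<Longrightarrow> x \<sqinter> y \<sqsubseteq> x"
  by (metis lat_le_def meet_assoc meet_comm meet_idem)

lemma meet_le2: "\<lbrakk>x \<in> carrier L; y \<in> carrier L\<rbrakk> \<Longrightarrow> x \<sqinter> y \<sqsubseteq> y"
  by (metis meet_le1 meet_comm)

lemma le_meet:
  "\<lbrakk>z \<sqsubseteq> x; z \<sqsubseteq> y; x \<in> carrier L; y \<in> carrier L; z \<in> carrier L\<rbrakk> \<Longrightarrow> z \<sqsubseteq> x \<sqinter> y"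
  by (metis lat_le_def meet_assoc)

lemma meet_mono:
  assumes "x \<sqsubseteq> u" "y \<sqsubseteq> v"
    and "x \<in> carrier L" "y \<in> carrier L" "u \<in> carrier L" "v \<in> carrier L"
  shows "x \<sqinter> y \<sqsubseteq> u \<sqinter> v"
proof (rule le_meet)
  show "x \<sqinter> y \<sqsubseteq> u" using assms meet_le1[of x y] by (meson le_trans meet_closed)
  show "x \<sqinter> y \<sqsubseteq> v" using assms meet_le2[of x y] by (meson le_trans meet_closed)
qed (simp_all add: assms closed)

lemma le_iff_join: "\<lbrakk>x \<in> carrier L; y \<in> carrier L\<rbrakk> \<Longrightarrow> x \<sqsubseteq> y \<longleftrightarrow> x \<squnion> y = y"
  by (metis lat_le_def join_absorb join_comm meet_absorb meet_comm)

lemma le_join1: "\<lbrakk>x \<in> carrier L; y \<in> carrier L\<rbrakk> \<Longrightarrow> x \<sqsubseteq> x \<squnion> y"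
  by (simp add: lat_le_def meet_absorb)

lemma le_join2: "\<lbrakk>x \<in> carrier L; y \<in> carrier L\<rbrakk> \<Longrightarrow> y \<sqsubseteq> x \<squnion> y"
  by (metis le_join1 join_comm)

lemma join_le:
  "\<lbrakk>x \<sqsubseteq> z; y \<sqsubseteq> z; x \<in> carrier L; y \<in> carrier L; z \<in> carrier L\<rbrakk> \<Longrightarrow> x \<squnion> y \<sqsubseteq> z"
  by (metis le_iff_join join_assoc join_closed)

lemma zero_le: "x \<in> carrier L \<Longrightarrow> \<zero> \<sqsubseteq> x"
  by (metis lat_le_def meet_comm meet_zero zero_closed)

lemma le_one: "x \<in> carrier L \<Longrightarrow> x \<sqsubseteq> \<one>"
  by (simp add: le_iff_join join_one one_closed)

lemma meet_one: "x \<in> carrier L \<Longrightarrow> x \<sqinter> \<one> = x"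
  using le_one by (simp add: lat_le_def)

lemma one_meet: "x \<in> carrier L \<Longrightarrow> \<one> \<sqinter> x = x"
  by (metis meet_comm meet_one one_closed)

lemma join_zero: "x \<in> carrier L \<Longrightarrow> x \<squnion> \<zero> = x"
  by (metis join_comm le_iff_join zero_closed zero_le)

lemma zero_join: "x \<in> carrier L \<Longrightarrow> \<zero> \<squnion> x = x"
  by (metis join_comm join_zero zero_closed)

lemma one_le_iff: "x \<in> carrier L \<Longrightarrow> \<one> \<sqsubseteq> x \<longleftrightarrow> x = \<one>"
  by (metis le_antisym le_one one_closed le_refl)

lemma le_zero_iff: "x \<in> carrier L \<Longrightarrow> x \<sqsubseteq> \<zero> \<longleftrightarrow> x = \<zero>"
  by (metis le_antisym zero_closed le_refl zero_le)

text \<open>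
  The semi-Heyting arrow need not be residuated with the meet, but \<open>x \<rightharpoonup> (x \<sqinter> y)\<close> always is.
\<close>

lemma residual:
  assumes "x \<in> carrier L" "y \<in> carrier L" "z \<in> carrier L"
  shows "z \<sqsubseteq> x \<rightharpoonup> (x \<sqinter> y) \<longleftrightarrow> z \<sqinter> x \<sqsubseteq> y"
proof
  assume "z \<sqinter> x \<sqsubseteq> y"
  then have "z \<sqinter> (x \<sqinter> y) = z \<sqinter> x"
    using assms by (simp add: lat_le_def meet_assoc)
  then have "z \<sqinter> (x \<rightharpoonup> (x \<sqinter> y)) = z \<sqinter> ((z \<sqinter> x) \<rightharpoonup> (z \<sqinter> x))"
    using meet_imp_meet[of z x "x \<sqinter> y"] assms by (simp add: closed)
  then show "z \<sqsubseteq> x \<rightharpoonup> (x \<sqinter> y)"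
    using assms by (simp add: lat_le_def closed imp_self meet_one)
next
  assume "z \<sqsubseteq> x \<rightharpoonup> (x \<sqinter> y)"
  then have "z \<sqinter> x = z \<sqinter> (x \<rightharpoonup> (x \<sqinter> y)) \<sqinter> x"
    by (simp add: lat_le_def)
  also have "\<dots> = z \<sqinter> (x \<sqinter> (x \<rightharpoonup> (x \<sqinter> y)))"
    using assms by (metis closed meet_assoc meet_comm)
  also have "\<dots> = z \<sqinter> (x \<sqinter> (x \<sqinter> y))"
    using assms by (simp add: meet_imp closed)
  also have "\<dots> = (z \<sqinter> x) \<sqinter> y"
    using assms by (simp add: closed meet_assoc[symmetric] meet_idem)
  finally show "z \<sqinter> x \<sqsubseteq> y"
    by (simp add: lat_le_def)
qed

text \<open>Distributivity of the lattice, in the form in which residuation yields it.\<close>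

lemma join_meet_le:
  assumes "x \<sqinter> z \<sqsubseteq> w" "y \<sqinter> z \<sqsubseteq> w"
    and "x \<in> carrier L" "y \<in> carrier L" "z \<in> carrier L" "w \<in> carrier L"
  shows "(x \<squnion> y) \<sqinter> z \<sqsubseteq> w"
  using assms by (simp flip: residual add: join_le closed)

lemma meet_star: "x \<in> carrier L \<Longrightarrow> x \<sqinter> star L x = \<zero>"
  by (simp add: star_def meet_imp meet_zero zero_closed)

lemma star_closed: "x \<in> carrier L \<Longrightarrow> star L x \<in> carrier L"
  by (simp add: star_def closed)

lemma le_star_iff:
  assumes "x \<in> carrier L" "y \<in> carrier L"
  shows "y \<sqsubseteq> star L x \<longleftrightarrow> y \<sqinter> x = \<zero>"
  using residual[of x \<zero> y] assms
  by (simp add: star_def zero_closed meet_zero le_zero_iff closed)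

lemma le_of_disjoint_cover:
  assumes "x \<sqinter> y = \<zero>" "z \<squnion> y = \<one>"
    and "x \<in> carrier L" "y \<in> carrier L" "z \<in> carrier L"
  shows "x \<sqsubseteq> z"
proof -
  have "(z \<squnion> y) \<sqinter> x \<sqsubseteq> z"
    using assms by (intro join_meet_le) (simp_all add: meet_le2 zero_le meet_comm[of _ x])
  then show ?thesis using assms by (simp add: one_meet)
qed

text \<open>
  Prime filters are proper here: \<open>\<zero>\<close> is excluded.
\<close>

definition lattice_filter :: "'a set \<Rightarrow> bool" where
  "lattice_filter F \<longleftrightarrow> F \<subseteq> carrier L \<and> \<one> \<in> F
    \<and> (\<forall>x \<in> F. \<forall>y \<in> carrier L. x \<sqsubseteq> y \<longrightarrow> y \<in> F)
    \<and> (\<forall>x \<in> F. \<forall>y \<in> F. x \<sqinter> y \<in> F)"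

definition prime_filter :: "'a set \<Rightarrow> bool" where
  "prime_filter F \<longleftrightarrow> lattice_filter F \<and> \<zero> \<notin> F
    \<and> (\<forall>x \<in> carrier L. \<forall>y \<in> carrier L. x \<squnion> y \<in> F \<longrightarrow> x \<in> F \<or> y \<in> F)"

lemma lattice_filter_extend:
  assumes F: "lattice_filter F" and x: "x \<in> carrier L"
  defines "G \<equiv> {z \<in> carrier L. \<exists>f \<in> F. f \<sqinter> x \<sqsubseteq> z}"
  shows "lattice_filter G" "F \<subseteq> G" "x \<in> G"
proof -
  have FL: "f \<in> carrier L" if "f \<in> F" for f
    using F that by (auto simp: lattice_filter_def)
  have one: "\<one> \<in> F" using F by (simp add: lattice_filter_def)
  show "F \<subseteq> G" unfolding G_def using FL x meet_le1 by blast
  show "x \<in> G" unfolding G_def using one x meet_le2 one_closed by blast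
  have "y \<in> G" if zy: "z \<in> G" "y \<in> carrier L" "z \<sqsubseteq> y" for z y
  proof -
    obtain f where f: "f \<in> F" "f \<sqinter> x \<sqsubseteq> z" and z: "z \<in> carrier L"
      using zy(1) by (auto simp: G_def)
    then have "f \<sqinter> x \<sqsubseteq> y" using zy(2,3) x FL by (meson le_trans meet_closed)
    then show ?thesis using f zy(2) by (auto simp: G_def)
  qed
  moreover have "y \<sqinter> z \<in> G" if yz: "y \<in> G" "z \<in> G" for y z
  proof -
    obtain f g where f: "f \<in> F" "f \<sqinter> x \<sqsubseteq> y" and g: "g \<in> F" "g \<sqinter> x \<sqsubseteq> z"
      and c: "y \<in> carrier L" "z \<in> carrier L"
      using yz by (auto simp: G_def)
    have fg: "f \<sqinter> g \<in> F" using F f g by (simp add: lattice_filter_def)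
    note cl = c x FL[OF f(1)] FL[OF g(1)]
    have "f \<sqinter> g \<sqinter> x \<sqsubseteq> f \<sqinter> x" "f \<sqinter> g \<sqinter> x \<sqsubseteq> g \<sqinter> x"
      using cl by (simp_all add: meet_mono meet_le1 meet_le2 le_refl closed)
    then have "f \<sqinter> g \<sqinter> x \<sqsubseteq> y" "f \<sqinter> g \<sqinter> x \<sqsubseteq> z"
      using cl f(2) g(2) by (meson closed(2) le_trans)+
    then have "f \<sqinter> g \<sqinter> x \<sqsubseteq> y \<sqinter> z"
      using cl by (simp add: le_meet closed)
    then show ?thesis using fg c by (auto simp: G_def closed)
  qed
  moreover have "\<one> \<in> G" using one \<open>F \<subseteq> G\<close> by blast
  moreover have "G \<subseteq> carrier L" by (auto simp: G_def)
  ultimately show "lattice_filter G" by (simp add: lattice_filter_def)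
qed

lemma ex_prime_filter:
  assumes d: "d \<in> carrier L" "d \<noteq> \<one>"
  obtains P where "prime_filter P" "d \<notin> P"
proof -
  define X where "X = {F. lattice_filter F \<and> d \<notin> F}"
  have "lattice_filter {\<one>}"
    by (auto simp: lattice_filter_def one_closed one_le_iff meet_one)
  then have ne: "X \<noteq> {}" using d by (auto simp: X_def)
  have "\<exists>M\<in>X. \<forall>F\<in>X. M \<subseteq> F \<longrightarrow> F = M"
  proof (rule subset_Zorn_nonempty[OF ne])
    fix Y assume Y: "Y \<noteq> {}" and ch: "subset.chain X Y"
    then have YX: "Y \<subseteq> X" by (simp add: subset.chain_def)
    have meet: "x \<sqinter> y \<in> \<Union>Y" if xy: "x \<in> \<Union>Y" "y \<in> \<Union>Y" for x y
    proof -
      obtain F G where FG: "F \<in> Y" "G \<in> Y" "x \<in> F" "y \<in> G" using xy by blast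
      then consider "F \<subseteq> G" | "G \<subseteq> F" using subset_chain_def ch by metis
      then obtain H where "H \<in> Y" "x \<in> H" "y \<in> H" using FG by cases auto
      then show ?thesis using YX by (auto simp: X_def lattice_filter_def)
    qed
    have "lattice_filter (\<Union>Y)"
      unfolding lattice_filter_def
    proof (intro conjI ballI impI meet)
      show "\<Union>Y \<subseteq> carrier L" "\<one> \<in> \<Union>Y"
        using YX Y by (auto simp: X_def lattice_filter_def)
    next
      fix x y assume "x \<in> \<Union>Y" "y \<in> carrier L" "x \<sqsubseteq> y"
      then show "y \<in> \<Union>Y" using YX unfolding X_def lattice_filter_def by blast
    qed
    then show "\<Union>Y \<in> X" using YX by (auto simp: X_def)
  qed
  then obtain P where P: "lattice_filter P" "d \<notin> P"
    and mx: "\<And>F. \<lbrakk>lattice_filter F; d \<notin> F; P \<subseteq> F\<rbrakk> \<Longrightarrow> F = P"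
    by (auto simp: X_def)
  have PL: "f \<in> carrier L" if "f \<in> P" for f
    using P that by (auto simp: lattice_filter_def)
  have up: "y \<in> P" if "x \<in> P" "y \<in> carrier L" "x \<sqsubseteq> y" for x y
    using P that by (auto simp: lattice_filter_def)
  \<comment> \<open>By maximality, adjoining an element outside \<open>P\<close> forces \<open>d\<close> into the filter.\<close>
  have below: "\<exists>f \<in> P. x \<sqinter> f \<sqsubseteq> d" if "x \<in> carrier L" "x \<notin> P" for x
  proof -
    define G where "G = {z \<in> carrier L. \<exists>f \<in> P. f \<sqinter> x \<sqsubseteq> z}"
    have "lattice_filter G" "P \<subseteq> G" "x \<in> G"
      unfolding G_def by (rule lattice_filter_extend[OF P(1) that(1)])+
    then have "d \<in> G" using mx[of G] that(2) by auto
    then obtain f where "f \<in> P" "f \<sqinter> x \<sqsubseteq> d" by (auto simp: G_def)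
    then show ?thesis using PL that(1) by (metis meet_comm)
  qed
  have "x \<in> P \<or> y \<in> P" if xy: "x \<in> carrier L" "y \<in> carrier L" "x \<squnion> y \<in> P" for x y
  proof (rule ccontr)
    assume "\<not> (x \<in> P \<or> y \<in> P)"
    then obtain f g where f: "f \<in> P" "x \<sqinter> f \<sqsubseteq> d" and g: "g \<in> P" "y \<sqinter> g \<sqsubseteq> d"
      using below xy by meson
    define e where "e = f \<sqinter> g"
    have e: "e \<in> P" using P f g by (simp add: lattice_filter_def e_def)
    note cl = xy(1,2) PL[OF f(1)] PL[OF g(1)] PL[OF e] d(1)
    have "x \<sqinter> e \<sqsubseteq> x \<sqinter> f" "y \<sqinter> e \<sqsubseteq> y \<sqinter> g"
      unfolding e_def using cl by (simp_all add: meet_mono meet_le1 meet_le2 le_refl closed)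
    then have "x \<sqinter> e \<sqsubseteq> d" "y \<sqinter> e \<sqsubseteq> d"
      using cl f(2) g(2) by (meson closed(2) le_trans)+
    then have "(x \<squnion> y) \<sqinter> e \<sqsubseteq> d" using cl by (intro join_meet_le)
    moreover have "(x \<squnion> y) \<sqinter> e \<in> P" using P e xy by (simp add: lattice_filter_def)
    ultimately show False using up d(1) P(2) by blast
  qed
  moreover have "\<zero> \<notin> P" using up[of \<zero> d] P(2) d(1) zero_le by blast
  ultimately have "prime_filter P" using P(1) by (auto simp: prime_filter_def)
  then show thesis using P(2) by (rule that)
qed

lemma joins_closed: "set xs \<subseteq> carrier L \<Longrightarrow> joins L xs \<in> carrier L"
proof (cases xs)
  case (Cons x ys)
  have "foldl (join L) y ys \<in> carrier L" if "y \<in> carrier L" "set ys \<subseteq> carrier L" for y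
    using that by (induction ys arbitrary: y) (auto simp: closed)
  moreover assume "set xs \<subseteq> carrier L"
  ultimately show ?thesis using Cons by simp
qed (simp add: zero_closed)

lemma prime_filter_joins:
  assumes P: "prime_filter P" and xs: "set xs \<subseteq> carrier L" "joins L xs \<in> P"
  shows "\<exists>x \<in> set xs. x \<in> P"
proof -
  have pr: "x \<in> P \<or> y \<in> P" if "x \<in> carrier L" "y \<in> carrier L" "x \<squnion> y \<in> P" for x y
    using P that by (simp add: prime_filter_def)
  have fold: "y \<in> P \<or> (\<exists>x \<in> set ys. x \<in> P)"
    if "y \<in> carrier L" "set ys \<subseteq> carrier L" "foldl (join L) y ys \<in> P" for y ys
    using that
  proof (induction ys arbitrary: y)
    case (Cons z zs)
    then have "y \<squnion> z \<in> P \<or> (\<exists>x \<in> set zs. x \<in> P)"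
      by (auto simp: closed)
    then show ?case using pr Cons.prems by auto
  qed simp
  show ?thesis
  proof (cases xs)
    case Nil
    then show ?thesis using xs P by (simp add: prime_filter_def)
  next
    case (Cons y ys)
    then show ?thesis using fold[of y ys] xs by auto
  qed
qed

lemma le_joins:
  assumes "set xs \<subseteq> carrier L" "x \<in> set xs"
  shows "x \<sqsubseteq> joins L xs"
proof -
  have start: "y \<sqsubseteq> foldl (join L) y ys" if "y \<in> carrier L" "set ys \<subseteq> carrier L" for y ys
    using that
  proof (induction ys arbitrary: y)
    case (Cons z zs)
    then have c: "z \<in> carrier L" "y \<in> carrier L" "set zs \<subseteq> carrier L" by auto
    then have "y \<squnion> z \<sqsubseteq> foldl (join L) (y \<squnion> z) zs" using Cons.IH by (simp add: closed)
    moreover have "foldl (join L) (y \<squnion> z) zs \<in> carrier L"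
      using joins_closed[of "(y \<squnion> z) # zs"] c by (simp add: closed)
    ultimately have "y \<sqsubseteq> foldl (join L) (y \<squnion> z) zs"
      using c by (meson closed(1) le_join1 le_trans)
    then show ?case by simp
  qed (simp add: le_refl)
  have fold: "x \<sqsubseteq> foldl (join L) y ys"
    if "y \<in> carrier L" "set ys \<subseteq> carrier L" "x \<in> set ys" for y ys
    using that
  proof (induction ys arbitrary: y)
    case (Cons z zs)
    then have c: "z \<in> carrier L" "y \<in> carrier L" "set zs \<subseteq> carrier L" by auto
    show ?case
    proof (cases "x \<in> set zs")
      case True
      then show ?thesis using Cons.IH[of "y \<squnion> z"] c by (simp add: closed)
    next
      case False
      then have "x = z" using Cons.prems by simp
      moreover have "foldl (join L) (y \<squnion> z) zs \<in> carrier L"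
        using joins_closed[of "(y \<squnion> z) # zs"] c by (simp add: closed)
      ultimately show ?thesis
        using start[of "y \<squnion> z" zs] c by simp (meson closed(1) le_join2 le_trans)
    qed
  qed simp
  show ?thesis
  proof (cases xs)
    case (Cons y ys)
    then show ?thesis using assms start[of y ys] fold[of y ys] by auto
  qed (use assms in simp)
qed

lemma joins_one: "\<lbrakk>set xs \<subseteq> carrier L; \<one> \<in> set xs\<rbrakk> \<Longrightarrow> joins L xs = \<one>"
  using le_joins[of xs \<one>] joins_closed one_le_iff by blast

end

context Heyting_algebra
begin

lemma meet_le_iff:
  assumes "x \<in> carrier L" "y \<in> carrier L" "z \<in> carrier L"
  shows "z \<sqsubseteq> x \<rightharpoonup> y \<longleftrightarrow> z \<sqinter> x \<sqsubseteq> y"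
proof
  assume "z \<sqinter> x \<sqsubseteq> y"
  \<comment> \<open>The defining identity makes the arrow from a smaller to a larger element equal to \<open>\<one>\<close>.\<close>
  then have "(z \<sqinter> x) \<rightharpoonup> (z \<sqinter> y) = \<one>"
    using meet_imp_one[of "z \<sqinter> x" "z \<sqinter> y"] assms
    by (metis lat_le_def closed(2) le_meet meet_le1)
  then show "z \<sqsubseteq> x \<rightharpoonup> y"
    using meet_imp_meet[of z x y] assms by (simp add: lat_le_def meet_one)
next
  assume "z \<sqsubseteq> x \<rightharpoonup> y"
  then have "z \<sqinter> x \<sqsubseteq> x \<sqinter> (x \<rightharpoonup> y)"
    using assms by (meson closed le_meet le_trans meet_le1 meet_le2)
  then show "z \<sqinter> x \<sqsubseteq> y"
    using assms by (metis closed le_trans meet_imp meet_le2)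
qed

lemma imp_eq_one_iff:
  "\<lbrakk>x \<in> carrier L; y \<in> carrier L\<rbrakk> \<Longrightarrow> x \<rightharpoonup> y = \<one> \<longleftrightarrow> x \<sqsubseteq> y"
  using meet_le_iff[of x y \<one>] by (simp add: one_le_iff one_meet closed)

lemma le_imp: "\<lbrakk>x \<in> carrier L; y \<in> carrier L\<rbrakk> \<Longrightarrow> y \<sqsubseteq> x \<rightharpoonup> y"
  by (simp add: meet_le_iff meet_le1)

end


section \<open>Dually Stone Heyting chains\<close>

text \<open>
  The identity \<open>x \<or> x' = 1\<close>, together with the identities of \<open>JIDL\<^sub>1\<close>.
\<close>

locale JIDL1_em = JIDL1 +
  assumes excluded_middle: "x \<in> carrier L \<Longrightarrow> x \<squnion> \<sim> x = \<one>"

text \<open>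
  The second identity: \<open>x\<^sub>1 \<or> \<dots> \<or> x\<^sub>n \<or> (x\<^sub>1 \<rightarrow> x\<^sub>2) \<or> \<dots> \<or> (x\<^sub>n\<^sub>-\<^sub>1 \<rightarrow> x\<^sub>n) = 1\<close>. In a Heyting chain it
  says that no \<open>n\<close> elements below \<open>1\<close> form a strictly descending sequence.
\<close>

definition chain_identity :: "nat \<Rightarrow> 'a dqd_algebra \<Rightarrow> bool" where
  "chain_identity n A \<longleftrightarrow> (\<forall>x :: nat \<Rightarrow> 'a. (\<forall>i \<in> {1..n}. x i \<in> carrier A) \<longrightarrow>
     joins A (map x [1..<n + 1] @ map (\<lambda>i. x i \<rightharpoonup>\<^bsub>A\<^esub> x (i + 1)) [1..<n]) = \<one>\<^bsub>A\<^esub>)"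

context dually_Stone_Heyting_chain
begin

lemma meet_chain: "\<lbrakk>x \<in> carrier L; y \<in> carrier L\<rbrakk> \<Longrightarrow> x \<sqinter> y = (if x \<sqsubseteq> y then x else y)"
  using chain[of x y] by (auto simp: lat_le_def meet_comm)

lemma join_chain: "\<lbrakk>x \<in> carrier L; y \<in> carrier L\<rbrakk> \<Longrightarrow> x \<squnion> y = (if x \<sqsubseteq> y then y else x)"
  using chain[of x y] by (auto simp: le_iff_join join_comm)

lemma imp_chain:
  assumes "x \<in> carrier L" "y \<in> carrier L"
  shows "x \<rightharpoonup> y = (if x \<sqsubseteq> y then \<one> else y)"
proof (cases "x \<sqsubseteq> y")
  case False
  have "x \<rightharpoonup> y \<sqsubseteq> y"
  proof (rule ccontr)
    assume "\<not> x \<rightharpoonup> y \<sqsubseteq> y"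
    have "x \<sqinter> (x \<rightharpoonup> y) = x \<sqinter> y" using assms by (rule meet_imp)
    then show False
      using False \<open>\<not> x \<rightharpoonup> y \<sqsubseteq> y\<close> assms
      by (metis closed(3) le_refl meet_chain)
  qed
  then show ?thesis using False assms le_imp le_antisym by (simp add: closed)
qed (simp add: imp_eq_one_iff assms)

lemma dneg_chain:
  assumes "x \<in> carrier L"
  shows "\<sim> x = (if x = \<one> then \<zero> else \<one>)"
proof (cases "x = \<one>")
  case False
  have "\<sim> x \<noteq> \<zero>"
  proof
    assume "\<sim> x = \<zero>"
    then have "\<one> \<sqsubseteq> x" using dneg_dneg_le[OF assms] by (simp add: dneg_zero)
    then show False using False assms one_le_iff by simp
  qed
  then have "\<sim> (\<sim> x) = \<zero>"
    using dually_Stone[OF assms] assms meet_chain[of "\<sim> x" "\<sim> (\<sim> x)"]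
    by (auto simp: dneg_closed split: if_splits)
  then have "\<sim> (\<sim> (\<sim> x)) = \<one>" by (simp add: dneg_zero)
  then have "\<one> \<sqsubseteq> \<sim> x" using dneg_dneg_le[of "\<sim> x"] assms by (simp add: dneg_closed)
  then show ?thesis using False assms by (simp add: one_le_iff dneg_closed)
qed (simp add: dneg_one)

lemma JIDL1_em: "JIDL1_em L"
proof unfold_locales
  fix x y z assume c: "x \<in> carrier L" "y \<in> carrier L" "z \<in> carrier L"
  show "\<sim> x \<squnion> (y \<rightharpoonup> z) = (\<sim> x \<squnion> y) \<rightharpoonup> (\<sim> x \<squnion> z)"
    using c by (cases "x = \<one>")
      (simp_all add: dneg_chain closed zero_join imp_self join_one join_comm[of \<one>])
next
  fix x y assume "x \<in> carrier L" "y \<in> carrier L"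
  then show "(x \<rightharpoonup> y) \<squnion> (y \<rightharpoonup> x) = \<one>"
    using chain[of x y]
    by (auto simp: imp_chain closed join_one join_comm[of \<one>])
next
  fix x assume x: "x \<in> carrier L"
  then have "\<one> = \<zero> \<Longrightarrow> x = \<one>" by (metis le_antisym le_one one_closed zero_le)
  then show "x \<sqinter> star L (\<sim> x) = star L (\<sim> (x \<sqinter> star L (\<sim> x)))"
    using x by (cases "x = \<one>") (auto simp: dneg_chain star_def closed imp_chain zero_le le_refl
        one_le_iff meet_zero meet_one)
next
  fix x assume "x \<in> carrier L"
  then show "x \<squnion> \<sim> x = \<one>"
    by (cases "x = \<one>") (simp_all add: dneg_chain join_one join_zero one_closed)
qed

lemma chain_identity:
  assumes "card (carrier L) = n" "n \<ge> 1"
  shows "chain_identity n L"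
  unfolding chain_identity_def
proof (intro allI impI)
  fix x :: "nat \<Rightarrow> 'a"
  assume x: "\<forall>i \<in> {1..n}. x i \<in> carrier L"
  let ?xs = "map x [1..<n + 1] @ map (\<lambda>i. x i \<rightharpoonup> x (i + 1)) [1..<n]"
  have fin: "finite (carrier L)" using assms by (metis card.infinite not_one_le_zero)
  have "\<one> \<in> set ?xs"
  proof (rule ccontr)
    assume n1: "\<one> \<notin> set ?xs"
    have xn: "x i \<noteq> \<one>" if "i \<in> {1..n}" for i
      using n1 that by (auto simp: image_iff)
    have desc: "\<not> x i \<sqsubseteq> x (Suc i)" if "i \<in> {1..<n}" for i
    proof -
      have "x i \<rightharpoonup> x (i + 1) \<in> set ?xs" using that by auto
      then have "x i \<rightharpoonup> x (i + 1) \<noteq> \<one>" using n1 by metis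
      then show ?thesis using that x by (simp add: imp_eq_one_iff)
    qed
    have lt: "x (i + Suc k) \<sqsubseteq> x i \<and> \<not> x i \<sqsubseteq> x (i + Suc k)" if "1 \<le> i" "i + Suc k \<le> n" for i k
      using that
    proof (induction k)
      case 0
      then show ?case using desc[of i] chain[of "x i" "x (Suc i)"] x by auto
    next
      case (Suc k)
      then have IH: "x (i + Suc k) \<sqsubseteq> x i \<and> \<not> x i \<sqsubseteq> x (i + Suc k)" by simp
      have c: "x i \<in> carrier L" "x (i + Suc k) \<in> carrier L" "x (i + Suc (Suc k)) \<in> carrier L"
        using Suc.prems x by auto
      have "x (i + Suc (Suc k)) \<sqsubseteq> x (i + Suc k)"
        using desc[of "i + Suc k"] Suc.prems chain[OF c(2,3)] by simp
      then show ?case using IH c le_trans by meson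
    qed
    have "inj_on x {1..n}"
    proof (rule linorder_inj_onI)
      fix i j assume ij: "i < j" "i \<in> {1..n}" "j \<in> {1..n}"
      then obtain k where "j = i + Suc k" using less_natE by auto
      then show "x i \<noteq> x j" using lt[of i k] ij by auto
    qed auto
    then have "card (x ` {1..n}) = n" by (simp add: card_image)
    moreover have "x ` {1..n} \<subseteq> carrier L - {\<one>}" using x xn by auto
    ultimately have "n \<le> card (carrier L - {\<one>})" using card_mono fin by (metis finite_Diff)
    then show False using assms fin one_closed by simp
  qed
  moreover have "set ?xs \<subseteq> carrier L" using x by (auto intro: closed)
  ultimately show "joins L ?xs = \<one>" by (intro joins_one)
qed

end

section \<open>Identities are preserved by powers, subalgebras and homomorphic images\<close>

lemma JIDL1_em_power:
  assumes "JIDL1_em C"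
  shows "JIDL1_em (power_algebra I C)"
proof -
  interpret C: JIDL1_em C by fact
  let ?B = "power_algebra I C"
  have at: "(f \<squnion>\<^bsub>?B\<^esub> g) i = f i \<squnion>\<^bsub>C\<^esub> g i" "(f \<sqinter>\<^bsub>?B\<^esub> g) i = f i \<sqinter>\<^bsub>C\<^esub> g i"
    "(f \<rightharpoonup>\<^bsub>?B\<^esub> g) i = f i \<rightharpoonup>\<^bsub>C\<^esub> g i" "(\<sim>\<^bsub>?B\<^esub> f) i = \<sim>\<^bsub>C\<^esub> (f i)"
    "\<zero>\<^bsub>?B\<^esub> i = \<zero>\<^bsub>C\<^esub>" "\<one>\<^bsub>?B\<^esub> i = \<one>\<^bsub>C\<^esub>"
    if "i \<in> I" for f g i
    using that by (simp_all add: power_algebra_def)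
  have mem: "f i \<in> carrier C" if "i \<in> I" "f \<in> carrier ?B" for f i
    using that by (auto simp: power_algebra_def)
  have cl: "f \<squnion>\<^bsub>?B\<^esub> g \<in> carrier ?B" "f \<sqinter>\<^bsub>?B\<^esub> g \<in> carrier ?B" "f \<rightharpoonup>\<^bsub>?B\<^esub> g \<in> carrier ?B"
    if "f \<in> carrier ?B" "g \<in> carrier ?B" for f g
    using that by (auto simp: power_algebra_def PiE_mem intro!: C.closed)
  have cl': "\<sim>\<^bsub>?B\<^esub> f \<in> carrier ?B" if "f \<in> carrier ?B" for f
    using that by (auto simp: power_algebra_def PiE_mem intro!: C.dneg_closed)
  have const_mem: "\<zero>\<^bsub>?B\<^esub> \<in> carrier ?B" "\<one>\<^bsub>?B\<^esub> \<in> carrier ?B"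
    by (auto simp: power_algebra_def C.closed)
  have eqI: "f = g" if "f \<in> carrier ?B" "g \<in> carrier ?B" "\<And>i. i \<in> I \<Longrightarrow> f i = g i" for f g
    using that by (auto simp: power_algebra_def intro: PiE_ext)
  note ax = C.join_comm C.meet_comm C.join_assoc C.meet_assoc C.join_absorb C.meet_absorb
    C.meet_zero C.join_one C.meet_imp C.meet_imp_meet C.imp_self C.dneg_zero C.dneg_one C.dneg_meet
    C.dneg_dneg_join C.dneg_dneg_le[unfolded lat_le_def] C.dneg_join_imp C.prelinear
    C.level_one[unfolded star_def] C.excluded_middle
  show ?thesis
    apply (unfold_locales; (intro cl cl' const_mem; assumption)?)
    apply (unfold lat_le_def star_def)
    apply (rule eqI; ((intro cl cl' const_mem)?; assumption)?; simp only: at; rule ax; rule mem;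
        assumption)+
    done
qed

lemma JIDL1_em_image:
  assumes "JIDL1_em B" and S: "dqd_subuniverse S B" and h: "dqd_hom S B A h"
    and surj: "h ` S = carrier A"
  shows "JIDL1_em A"
proof -
  interpret B: JIDL1_em B by fact
  have SB: "x \<in> carrier B" if "x \<in> S" for x
    using S that by (auto simp: dqd_subuniverse_def)
  have cl: "x \<squnion>\<^bsub>B\<^esub> y \<in> S" "x \<sqinter>\<^bsub>B\<^esub> y \<in> S" "x \<rightharpoonup>\<^bsub>B\<^esub> y \<in> S"
    if "x \<in> S" "y \<in> S" for x y
    using S that by (simp_all add: dqd_subuniverse_def)
  have cl': "\<sim>\<^bsub>B\<^esub> x \<in> S" if "x \<in> S" for x
    using S that by (simp add: dqd_subuniverse_def)
  have const_mem: "\<zero>\<^bsub>B\<^esub> \<in> S" "\<one>\<^bsub>B\<^esub> \<in> S" using S by (simp_all add: dqd_subuniverse_def)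
  have hom: "h x \<squnion>\<^bsub>A\<^esub> h y = h (x \<squnion>\<^bsub>B\<^esub> y)" "h x \<sqinter>\<^bsub>A\<^esub> h y = h (x \<sqinter>\<^bsub>B\<^esub> y)"
    "h x \<rightharpoonup>\<^bsub>A\<^esub> h y = h (x \<rightharpoonup>\<^bsub>B\<^esub> y)"
    if "x \<in> S" "y \<in> S" for x y
    using h that by (simp_all add: dqd_hom_def)
  have hom': "\<sim>\<^bsub>A\<^esub> (h x) = h (\<sim>\<^bsub>B\<^esub> x)" if "x \<in> S" for x
    using h that by (simp add: dqd_hom_def)
  have hom_const: "\<zero>\<^bsub>A\<^esub> = h \<zero>\<^bsub>B\<^esub>" "\<one>\<^bsub>A\<^esub> = h \<one>\<^bsub>B\<^esub>" using h by (simp_all add: dqd_hom_def)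
  note ax = B.join_comm B.meet_comm B.join_assoc B.meet_assoc B.join_absorb B.meet_absorb
    B.meet_zero B.join_one B.meet_imp B.meet_imp_meet B.imp_self B.dneg_zero B.dneg_one B.dneg_meet
    B.dneg_dneg_join B.dneg_dneg_le[unfolded lat_le_def] B.dneg_join_imp B.prelinear
    B.level_one[unfolded star_def] B.excluded_middle
  show ?thesis
    by (unfold_locales; unfold surj[symmetric] lat_le_def star_def hom_const; (elim imageE)?;
        (simp only: hom hom' cl cl' const_mem imageI)?; rule arg_cong[of _ _ h]; rule ax;
        intro SB cl cl' const_mem; assumption)
qed


lemma joins_hom:
  assumes S: "dqd_subuniverse S B" and h: "dqd_hom S B A h" and xs: "set xs \<subseteq> S"
  shows "joins B xs \<in> S \<and> h (joins B xs) = joins A (map h xs)"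
proof (cases xs)
  case Nil
  then show ?thesis using S h by (simp add: dqd_subuniverse_def dqd_hom_def)
next
  case (Cons y ys)
  have "foldl (join B) y ys \<in> S \<and> h (foldl (join B) y ys) = foldl (join A) (h y) (map h ys)"
    if "y \<in> S" "set ys \<subseteq> S" for y ys
    using that
  proof (induction ys arbitrary: y)
    case (Cons z zs)
    then show ?case using S h by (simp add: dqd_subuniverse_def dqd_hom_def)
  qed simp
  then show ?thesis using Cons xs by simp
qed

lemma chain_identity_image:
  assumes "chain_identity n B" and S: "dqd_subuniverse S B" and h: "dqd_hom S B A h"
    and surj: "h ` S = carrier A"
  shows "chain_identity n A"
  unfolding chain_identity_def
proof (intro allI impI)
  fix x :: "nat \<Rightarrow> 'b"
  assume x: "\<forall>i \<in> {1..n}. x i \<in> carrier A"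
  define y where "y i = (SOME s. s \<in> S \<and> h s = x i)" for i
  have y: "y i \<in> S \<and> h (y i) = x i" if "i \<in> {1..n}" for i
  proof -
    have "\<exists>s. s \<in> S \<and> h s = x i" using x that surj by (metis imageE)
    then show ?thesis unfolding y_def by (rule someI_ex)
  qed
  let ?ys = "map y [1..<n + 1] @ map (\<lambda>i. y i \<rightharpoonup>\<^bsub>B\<^esub> y (i + 1)) [1..<n]"
  let ?xs = "map x [1..<n + 1] @ map (\<lambda>i. x i \<rightharpoonup>\<^bsub>A\<^esub> x (i + 1)) [1..<n]"
  have "map h ?ys = ?xs"
    using h y by (auto simp: dqd_hom_def)
  moreover have "set ?ys \<subseteq> S" using S y by (auto simp: dqd_subuniverse_def)
  ultimately have "h (joins B ?ys) = joins A ?xs" using joins_hom[OF S h] by metis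
  moreover have "joins B ?ys = \<one>\<^bsub>B\<^esub>"
  proof -
    have "\<forall>i \<in> {1..n}. y i \<in> carrier B" using y S by (auto simp: dqd_subuniverse_def)
    then show ?thesis using assms(1) unfolding chain_identity_def by simp
  qed
  ultimately show "joins A ?xs = \<one>\<^bsub>A\<^esub>" using h by (simp add: dqd_hom_def)
qed

lemma chain_identity_power:
  assumes "JIDL1_em C" "chain_identity n C"
  shows "chain_identity n (power_algebra I C)"
  unfolding chain_identity_def
proof (intro allI impI)
  let ?B = "power_algebra I C"
  interpret B: JIDL1_em ?B using assms(1) by (rule JIDL1_em_power)
  fix x :: "nat \<Rightarrow> 'b \<Rightarrow> 'a"
  assume x: "\<forall>i \<in> {1..n}. x i \<in> carrier ?B"
  let ?xs = "map x [1..<n + 1] @ map (\<lambda>i. x i \<rightharpoonup>\<^bsub>?B\<^esub> x (i + 1)) [1..<n]"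
  have sub: "dqd_subuniverse (carrier ?B) ?B"
    by (simp add: dqd_subuniverse_def B.closed B.dneg_closed)
  have xs: "set ?xs \<subseteq> carrier ?B" using x by (auto intro: B.closed)
  have "joins ?B ?xs j = \<one>\<^bsub>C\<^esub>" if j: "j \<in> I" for j
  proof -
    \<comment> \<open>Each coordinate projection is a homomorphism.\<close>
    have p: "dqd_hom (carrier ?B) ?B C (\<lambda>f. f j)"
      using j by (auto simp: dqd_hom_def power_algebra_def)
    have "joins ?B ?xs j = joins C (map (\<lambda>f. f j) ?xs)"
      using joins_hom[OF sub p xs] by blast
    also have "map (\<lambda>f. f j) ?xs
      = map (\<lambda>i. x i j) [1..<n + 1] @ map (\<lambda>i. x i j \<rightharpoonup>\<^bsub>C\<^esub> x (i + 1) j) [1..<n]"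
      using j by (simp add: power_algebra_def)
    also have "joins C \<dots> = \<one>\<^bsub>C\<^esub>"
    proof -
      have "\<forall>i \<in> {1..n}. x i j \<in> carrier C" using x j by (auto simp: power_algebra_def)
      then show ?thesis using assms(2)[unfolded chain_identity_def, rule_format, of "\<lambda>i. x i j"]
        by simp
    qed
    finally show ?thesis .
  qed
  moreover have "joins ?B ?xs \<in> carrier ?B" using xs by (rule B.joins_closed)
  ultimately show "joins ?B ?xs = \<one>\<^bsub>?B\<^esub>"
    by (auto simp: power_algebra_def intro!: PiE_ext[where k = I])
qed

section \<open>The arrow and the double dual negation\<close>

context JIDL1_em
begin

text \<open>
  If \<open>u = x \<sqinter> y\<close> and \<open>q = y \<rightharpoonup> u\<close>, then \<open>q \<sqinter> y = u = q \<sqinter> u\<close>, hence \<open>q \<sqinter> (u \<rightharpoonup> y) = q \<sqinter> \<one>\<close>; so \<open>q\<close>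
  lies below \<open>u \<rightharpoonup> y\<close>, and by prelinearity the latter is \<open>\<one>\<close>.
\<close>

lemma Heyting: "Heyting_algebra L"
proof unfold_locales
  fix x y assume c: "x \<in> carrier L" "y \<in> carrier L"
  define u where "u = x \<sqinter> y"
  define q where "q = y \<rightharpoonup> u"
  have cu: "u \<in> carrier L" and cq: "q \<in> carrier L" by (simp_all add: u_def q_def c closed)
  have "y \<sqinter> u = u" using c by (metis lat_le_def meet_comm meet_le2 cu u_def)
  then have qy: "q \<sqinter> y = u" using c cu cq by (simp add: q_def meet_imp meet_comm[of _ y])
  then have qu: "q \<sqinter> u = u" using c cu cq by (metis meet_assoc meet_idem)
  have "q \<sqinter> (u \<rightharpoonup> y) = q"
    using meet_imp_meet[OF cq cu c(2)] c cu cq by (simp add: qy qu imp_self meet_one)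
  then have "q \<squnion> (u \<rightharpoonup> y) = u \<rightharpoonup> y"
    using le_iff_join[OF cq] c cu by (simp add: lat_le_def closed)
  then show "(x \<sqinter> y) \<rightharpoonup> y = \<one>"
    using prelinear[OF cu c(2)] c cu cq
    unfolding u_def[symmetric] q_def[symmetric] by (metis closed(3) join_comm)
qed

sublocale Heyting_algebra L by (rule Heyting)

lemma dneg_antimono:
  "\<lbrakk>x \<sqsubseteq> y; x \<in> carrier L; y \<in> carrier L\<rbrakk> \<Longrightarrow> \<sim> y \<sqsubseteq> \<sim> x"
  by (metis dneg_closed dneg_meet lat_le_def le_join2)

lemma dneg3: "x \<in> carrier L \<Longrightarrow> \<sim> (\<sim> (\<sim> x)) = \<sim> x"
  by (meson dneg_antimono dneg_closed dneg_dneg_le le_antisym)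

text \<open>
  Dual negations are complemented: instantiate the distributivity of \<open>x' \<or> _\<close> over the arrow with
  \<open>x' \<rightarrow> 0\<close>.
\<close>

lemma dneg_join_star: "x \<in> carrier L \<Longrightarrow> \<sim> x \<squnion> star L (\<sim> x) = \<one>"
  using dneg_join_imp[of x "\<sim> x" \<zero>]
  by (simp add: star_def dneg_closed zero_closed join_idem join_zero imp_self)

lemma star_dneg_le: "x \<in> carrier L \<Longrightarrow> star L (\<sim> x) \<sqsubseteq> x"
  by (rule le_of_disjoint_cover[where y = "\<sim> x"])
    (simp_all add: dneg_closed star_closed excluded_middle meet_comm[of _ "\<sim> x"] meet_star)

text \<open>
  The last identity of \<open>JIDL\<^sub>1\<close> gives \<open>x'\<^sup>* = x'\<^sup>*'\<^sup>*\<close>, because \<open>x'\<^sup>* \<sqsubseteq> x\<close>. So \<open>x'\<close> and \<open>x'\<^sup>*'\<close> are both complements of \<open>x'\<^sup>*\<close>. Consequently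
  \<open>x'' = x'\<^sup>*''\<close>, which is at most \<open>x'\<^sup>*\<close>; the converse
  inequality holds because \<open>x' \<or> x'' = 1\<close>.
\<close>

lemma dneg_dneg_eq:
  assumes "x \<in> carrier L"
  shows "\<sim> (\<sim> x) = star L (\<sim> x)"
proof -
  define b where "b = star L (\<sim> x)"
  have c: "\<sim> x \<in> carrier L" "b \<in> carrier L" "\<sim> b \<in> carrier L" "\<sim> (\<sim> x) \<in> carrier L"
    by (simp_all add: b_def assms dneg_closed star_closed)
  have "x \<sqinter> b = b"
    using star_dneg_le[OF assms] c assms by (simp add: b_def lat_le_def meet_comm)
  then have lev: "b = star L (\<sim> b)"
    using level_one[OF assms] by (simp add: b_def)
  have 1: "\<sim> x \<sqinter> b = \<zero>" "\<sim> b \<sqinter> b = \<zero>"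
    using meet_star[of "\<sim> x"] meet_star[of "\<sim> b"] c lev by (simp_all flip: b_def)
  have 2: "\<sim> x \<squnion> b = \<one>" "\<sim> b \<squnion> b = \<one>"
    using dneg_join_star[of x] dneg_join_star[of b] c assms lev by (simp_all flip: b_def)
  have "\<sim> b = \<sim> x"
    using 1 2 c by (intro le_antisym) (auto intro: le_of_disjoint_cover)
  then have "\<sim> (\<sim> x) \<sqsubseteq> b" using dneg_dneg_le[of b] c by simp
  moreover have "b \<sqsubseteq> \<sim> (\<sim> x)"
    using excluded_middle[of "\<sim> x"] 1 c
    by (intro le_of_disjoint_cover[of b "\<sim> x"]) (simp_all add: meet_comm join_comm)
  ultimately show ?thesis using c by (simp add: le_antisym flip: b_def)
qed

section \<open>The filter of elements whose double dual negation lies in a prime filter\<close>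

text \<open>
  In the cases of interest \<open>P\<close> is a prime filter. The core is stable under the operation
  \<open>x \<mapsto> x'\<^sup>*\<close>, so it is then the top class of a congruence, the one relating \<open>x\<close> to \<open>y\<close> when
  \<open>x \<rightharpoonup> y\<close> and \<open>y \<rightharpoonup> x\<close> belong to it.
\<close>

definition core :: "'a set \<Rightarrow> 'a set" where
  "core P = {x \<in> carrier L. \<sim> (\<sim> x) \<in> P}"

lemma prime_filter_core:
  assumes P: "prime_filter P"
  shows "prime_filter (core P)"
proof -
  have up: "y \<in> P" if "x \<in> P" "x \<sqsubseteq> y" "y \<in> carrier L" for x y
    using P that by (auto simp: prime_filter_def lattice_filter_def)
  have meetP: "x \<sqinter> y \<in> P" if "x \<in> P" "y \<in> P" for x y
    using P that by (auto simp: prime_filter_def lattice_filter_def)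
  have "x \<sqinter> y \<in> core P" if xy: "x \<in> core P" "y \<in> core P" for x y
  proof -
    have c: "x \<in> carrier L" "y \<in> carrier L" using xy by (simp_all add: core_def)
    define p where "p = \<sim> (\<sim> x) \<sqinter> \<sim> (\<sim> y)"
    have p: "p \<in> P" using xy by (simp add: core_def p_def meetP)
    have cc: "p \<in> carrier L" "\<sim> x \<in> carrier L" "\<sim> y \<in> carrier L"
      by (simp_all add: p_def c dneg_closed closed)
    have "p \<sqsubseteq> star L (\<sim> x)" "p \<sqsubseteq> star L (\<sim> y)"
      using c by (simp_all add: p_def dneg_dneg_eq[symmetric] dneg_closed meet_le1 meet_le2)
    then have "\<sim> x \<sqinter> p = \<zero>" "\<sim> y \<sqinter> p = \<zero>" using cc by (simp_all add: le_star_iff meet_comm)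
    then have "(\<sim> x \<squnion> \<sim> y) \<sqinter> p \<sqsubseteq> \<zero>"
      using cc by (intro join_meet_le) (simp_all add: closed le_refl)
    then have "p \<sqsubseteq> star L (\<sim> (x \<sqinter> y))"
      using cc c by (simp add: le_star_iff dneg_meet closed le_zero_iff meet_comm)
    then have "p \<sqsubseteq> \<sim> (\<sim> (x \<sqinter> y))" using c by (simp add: dneg_dneg_eq closed)
    then show ?thesis using p up c by (simp add: core_def dneg_closed closed)
  qed
  moreover have "y \<in> core P" if "x \<in> core P" "y \<in> carrier L" "x \<sqsubseteq> y" for x y
    using that up by (auto simp: core_def intro: dneg_antimono dneg_closed)
  ultimately show ?thesis
    using P by (auto simp: prime_filter_def lattice_filter_def core_def dneg_zero dneg_one
        closed dneg_dneg_join dneg_closed)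
qed

lemma dneg_in_core_iff:
  assumes P: "prime_filter P" and x: "x \<in> carrier L"
  shows "\<sim> x \<in> core P \<longleftrightarrow> x \<notin> core P"
proof -
  have "\<sim> x \<squnion> \<sim> (\<sim> x) = \<one>" using x by (simp add: excluded_middle dneg_closed)
  moreover have "\<one> \<in> P" using P by (simp add: prime_filter_def lattice_filter_def)
  ultimately have "\<sim> x \<in> P \<or> \<sim> (\<sim> x) \<in> P"
    using P x by (simp add: prime_filter_def dneg_closed)
  moreover have "\<not> (\<sim> x \<in> P \<and> \<sim> (\<sim> x) \<in> P)"
  proof
    assume "\<sim> x \<in> P \<and> \<sim> (\<sim> x) \<in> P"
    then have "\<sim> x \<sqinter> \<sim> (\<sim> x) \<in> P" using P by (simp add: prime_filter_def lattice_filter_def)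
    then show False
      using P x by (simp add: dneg_dneg_eq meet_star dneg_closed prime_filter_def)
  qed
  ultimately show ?thesis using x by (auto simp: core_def dneg3 dneg_closed)
qed

lemma star_dneg_in_core:
  assumes "x \<in> core P"
  shows "star L (\<sim> x) \<in> core P"
  using assms by (simp add: core_def dneg_dneg_eq[symmetric] dneg3 dneg_closed)

lemma mem_filter_mono:
  "\<lbrakk>prime_filter F; x \<in> F; x \<sqsubseteq> y; y \<in> carrier L\<rbrakk> \<Longrightarrow> y \<in> F"
  by (auto simp: prime_filter_def lattice_filter_def)

lemma imp_mem_trans:
  assumes F: "prime_filter F" and m: "x \<rightharpoonup> y \<in> F" "y \<rightharpoonup> z \<in> F"
    and c: "x \<in> carrier L" "y \<in> carrier L" "z \<in> carrier L"
  shows "x \<rightharpoonup> z \<in> F"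
proof -
  define p q where "p = x \<rightharpoonup> y" and "q = y \<rightharpoonup> z"
  have cc: "p \<in> carrier L" "q \<in> carrier L" by (simp_all add: p_def q_def c closed)
  have "p \<sqinter> x \<sqsubseteq> y" "q \<sqinter> y \<sqsubseteq> z"
    using meet_le_iff[OF c(1,2) cc(1)] meet_le_iff[OF c(2,3) cc(2)] cc
    by (simp_all add: le_refl flip: p_def q_def)
  then have "q \<sqinter> (p \<sqinter> x) \<sqsubseteq> q \<sqinter> y" "q \<sqinter> y \<sqsubseteq> z"
    using c cc by (simp_all add: meet_mono le_refl closed)
  then have "q \<sqinter> (p \<sqinter> x) \<sqsubseteq> z" using c cc by (meson closed(2) le_trans)
  then have "q \<sqinter> p \<sqsubseteq> x \<rightharpoonup> z" using c cc by (simp add: meet_le_iff closed meet_assoc)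
  moreover have "q \<sqinter> p \<in> F"
    using F m by (simp add: p_def q_def prime_filter_def lattice_filter_def)
  ultimately show ?thesis using F c mem_filter_mono by (simp add: closed)
qed

lemma imp_mem_total:
  "\<lbrakk>prime_filter F; x \<in> carrier L; y \<in> carrier L\<rbrakk> \<Longrightarrow> x \<rightharpoonup> y \<in> F \<or> y \<rightharpoonup> x \<in> F"
  using prelinear[of x y] by (simp add: prime_filter_def lattice_filter_def closed)

lemma imp_mem_of_le:
  "\<lbrakk>prime_filter F; x \<sqsubseteq> y; x \<in> carrier L; y \<in> carrier L\<rbrakk> \<Longrightarrow> x \<rightharpoonup> y \<in> F"
  by (simp add: prime_filter_def lattice_filter_def imp_eq_one_iff[THEN iffD2])

lemma imp_mem_of_mem:
  "\<lbrakk>prime_filter F; y \<in> F; x \<in> carrier L; y \<in> carrier L\<rbrakk> \<Longrightarrow> x \<rightharpoonup> y \<in> F"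
  by (meson closed(3) le_imp mem_filter_mono)

section \<open>Order embeddings of the quotient chain are homomorphisms\<close>

text \<open>
  The hypothesis \<open>emb\<close> says that \<open>h\<close> embeds the chain of classes of the preorder \<open>x \<rightharpoonup> y \<in> core P\<close>
  into \<open>D\<close>.
\<close>

lemma hom_of_quotient_embedding:
  fixes D :: "'c dqd_algebra"
  assumes D: "dually_Stone_Heyting_chain D" and P: "prime_filter P"
    and h: "\<And>x. x \<in> carrier L \<Longrightarrow> h x \<in> carrier D"
    and emb: "\<And>x y. \<lbrakk>x \<in> carrier L; y \<in> carrier L\<rbrakk> \<Longrightarrow> lat_le D (h x) (h y) \<longleftrightarrow> x \<rightharpoonup> y \<in> core P"
    and h0: "h \<zero> = \<zero>\<^bsub>D\<^esub>" and h1: "h \<one> = \<one>\<^bsub>D\<^esub>"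
  shows "dqd_hom (carrier L) L D h"
proof -
  interpret D: dually_Stone_Heyting_chain D by fact
  define F where "F = core P"
  have F: "prime_filter F" unfolding F_def using P by (rule prime_filter_core)
  note emb = emb[folded F_def]
  have eq: "h x = h y" if "x \<rightharpoonup> y \<in> F" "y \<rightharpoonup> x \<in> F" "x \<in> carrier L" "y \<in> carrier L" for x y
    using that emb h D.le_antisym by blast
  have top: "h x = \<one>\<^bsub>D\<^esub> \<longleftrightarrow> x \<in> F" if x: "x \<in> carrier L" for x
  proof -
    have "\<one> \<rightharpoonup> x = x"
      using meet_imp[of \<one> x] x by (simp add: one_meet closed)
    then show ?thesis using emb[of \<one> x] x h[OF x] by (simp add: h1 D.one_le_iff one_closed)
  qed
  have monoF: "lat_le D (h x) (h y)" if "x \<sqsubseteq> y" "x \<in> carrier L" "y \<in> carrier L" for x y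
    using that emb imp_mem_of_le[OF F] by simp
  have meet: "h (x \<sqinter> y) = h x \<sqinter>\<^bsub>D\<^esub> h y" and join: "h (x \<squnion> y) = h x \<squnion>\<^bsub>D\<^esub> h y"
    if xy: "x \<rightharpoonup> y \<in> F" and c: "x \<in> carrier L" "y \<in> carrier L" for x y
  proof -
    have le: "lat_le D (h x) (h y)" using xy emb c by simp
    have "x \<rightharpoonup> y \<sqsubseteq> x \<rightharpoonup> (x \<sqinter> y)" "x \<rightharpoonup> y \<sqsubseteq> (x \<squnion> y) \<rightharpoonup> y"
    proof -
      have "(x \<rightharpoonup> y) \<sqinter> x \<sqsubseteq> y" using c meet_le_iff[of x y "x \<rightharpoonup> y"] by (simp add: le_refl closed)
      then show "x \<rightharpoonup> y \<sqsubseteq> x \<rightharpoonup> (x \<sqinter> y)" "x \<rightharpoonup> y \<sqsubseteq> (x \<squnion> y) \<rightharpoonup> y"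
        using c join_meet_le[of x "x \<rightharpoonup> y" y y]
        by (simp_all add: meet_le_iff closed le_meet meet_le1 meet_le2 meet_comm)
    qed
    then have "x \<rightharpoonup> (x \<sqinter> y) \<in> F" "(x \<squnion> y) \<rightharpoonup> y \<in> F"
      using F xy c by (meson closed mem_filter_mono)+
    then have "h (x \<sqinter> y) = h x" "h (x \<squnion> y) = h y"
      using c F by (auto intro!: eq imp_mem_of_le simp: closed meet_le1 le_join2)
    then show "h (x \<sqinter> y) = h x \<sqinter>\<^bsub>D\<^esub> h y" "h (x \<squnion> y) = h x \<squnion>\<^bsub>D\<^esub> h y"
      using le c h by (simp_all add: D.meet_chain D.join_chain)
  qed
  have imp: "h (x \<rightharpoonup> y) = h x \<rightharpoonup>\<^bsub>D\<^esub> h y" if c: "x \<in> carrier L" "y \<in> carrier L" for x y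
  proof (cases "x \<rightharpoonup> y \<in> F")
    case True
    then show ?thesis using c h emb[of x y] top[of "x \<rightharpoonup> y"] by (simp add: D.imp_chain closed)
  next
    case False
    \<comment> \<open>The class of \<open>x \<rightharpoonup> y\<close> is that of \<open>y\<close>: if \<open>x\<close> were below \<open>x \<rightharpoonup> y\<close> modulo \<open>F\<close>, then
      \<open>x \<rightharpoonup> (x \<rightharpoonup> y)\<close>, hence \<open>x \<rightharpoonup> y\<close>, would lie in \<open>F\<close>. So \<open>x \<rightharpoonup> y\<close> is below \<open>x\<close>, and by modus
      ponens it is below \<open>y\<close>.\<close>
    have ci: "x \<rightharpoonup> y \<in> carrier L" using c by (rule closed)
    have mp: "x \<sqinter> (x \<rightharpoonup> y) \<sqsubseteq> y" using c by (simp add: meet_imp meet_le2)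
    have "x \<rightharpoonup> (x \<rightharpoonup> y) \<sqsubseteq> x \<rightharpoonup> y"
    proof -
      define p where "p = x \<rightharpoonup> (x \<rightharpoonup> y)"
      have p: "p \<in> carrier L" using c ci by (simp add: p_def closed)
      have "p \<sqinter> x \<sqsubseteq> x \<rightharpoonup> y" using meet_le_iff[OF c(1) ci p] p by (simp add: le_refl flip: p_def)
      then have "p \<sqinter> x \<sqsubseteq> x \<sqinter> (x \<rightharpoonup> y)" using c ci p by (simp add: le_meet meet_le2 closed)
      then have "p \<sqinter> x \<sqsubseteq> y" using mp c ci p by (meson closed(2) le_trans)
      then show ?thesis using c p by (simp add: meet_le_iff flip: p_def)
    qed
    then have "x \<rightharpoonup> (x \<rightharpoonup> y) \<notin> F" using False F ci mem_filter_mono by blast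
    then have qF: "(x \<rightharpoonup> y) \<rightharpoonup> x \<in> F" using imp_mem_total[OF F c(1) ci] by simp
    have "(x \<rightharpoonup> y) \<rightharpoonup> x \<sqsubseteq> (x \<rightharpoonup> y) \<rightharpoonup> y"
    proof -
      define q where "q = (x \<rightharpoonup> y) \<rightharpoonup> x"
      have q: "q \<in> carrier L" using c ci by (simp add: q_def closed)
      have "q \<sqinter> (x \<rightharpoonup> y) \<sqsubseteq> x" using meet_le_iff[OF ci c(1) q] q by (simp add: le_refl flip: q_def)
      then have "q \<sqinter> (x \<rightharpoonup> y) \<sqsubseteq> x \<sqinter> (x \<rightharpoonup> y)" using c ci q by (simp add: le_meet meet_le2 closed)
      then have "q \<sqinter> (x \<rightharpoonup> y) \<sqsubseteq> y" using mp c ci q by (meson closed(2) le_trans)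
      then show ?thesis using c ci q by (simp add: meet_le_iff flip: q_def)
    qed
    then have "(x \<rightharpoonup> y) \<rightharpoonup> y \<in> F" using qF F c ci by (meson closed(3) mem_filter_mono)
    moreover have "y \<rightharpoonup> (x \<rightharpoonup> y) \<in> F" using imp_mem_of_le[OF F le_imp[OF c]] c ci by simp
    ultimately have "h (x \<rightharpoonup> y) = h y" using c ci by (intro eq)
    then show ?thesis using False emb[OF c] c h by (simp add: D.imp_chain)
  qed
  have dneg: "h (\<sim> x) = \<sim>\<^bsub>D\<^esub> (h x)" if x: "x \<in> carrier L" for x
  proof (cases "x \<in> F")
    case True
    then have "\<sim> x \<rightharpoonup> \<zero> \<in> F" using star_dneg_in_core by (simp add: F_def star_def)
    then have "lat_le D (h (\<sim> x)) \<zero>\<^bsub>D\<^esub>"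
      using emb[of "\<sim> x" \<zero>] x by (simp add: dneg_closed zero_closed h0)
    then show ?thesis
      using True x top h by (simp add: D.le_zero_iff dneg_closed D.dneg_chain)
  next
    case False
    then have "\<sim> x \<in> F" using dneg_in_core_iff[OF P x] by (simp add: F_def)
    then show ?thesis using False x top h by (simp add: dneg_closed D.dneg_chain)
  qed
  have "h (x \<sqinter> y) = h x \<sqinter>\<^bsub>D\<^esub> h y \<and> h (x \<squnion> y) = h x \<squnion>\<^bsub>D\<^esub> h y"
    if c: "x \<in> carrier L" "y \<in> carrier L" for x y
    using imp_mem_total[OF F c]
  proof
    assume "y \<rightharpoonup> x \<in> F"
    then show ?thesis using meet[of y x] join[of y x] c h
      by (simp add: meet_comm join_comm D.meet_comm D.join_comm)
  qed (use meet join c in simp)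
  then show ?thesis
    unfolding dqd_hom_def using h imp dneg h0 h1 by auto
qed

section \<open>The height in the quotient chain\<close>

text \<open>
  \<open>descending F x k s\<close>: the classes of \<open>x = s 0, \<dots>, s k\<close> modulo \<open>F\<close> strictly descend. In the
  linearly ordered quotient by a prime filter, \<open>s i\<close> strictly above \<open>s (i + 1)\<close> amounts to \<open>s i \<rightharpoonup> s (i + 1) \<notin> F\<close>.
\<close>

definition descending :: "'a set \<Rightarrow> 'a \<Rightarrow> nat \<Rightarrow> (nat \<Rightarrow> 'a) \<Rightarrow> bool" where
  "descending F x k s \<longleftrightarrow> s 0 = x \<and> (\<forall>i \<le> k. s i \<in> carrier L) \<and> (\<forall>i < k. s i \<rightharpoonup> s (Suc i) \<notin> F)"

text \<open>
  The greatest length of a sequence descending strictly from the class of \<open>x\<close>. It is meaningful when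
  these lengths are bounded, which is proved for \<open>x\<close> outside \<open>F\<close>.
\<close>

definition height :: "'a set \<Rightarrow> 'a \<Rightarrow> nat" where
  "height F x = (GREATEST k. \<exists>s. descending F x k s)"

text \<open>
  With \<open>n \<le> k + 1\<close>, the join of \<open>s 0, \<dots>, s (n - 1)\<close> and the arrows between neighbours would be \<open>\<one>\<close>, so
  one of these elements would lie in \<open>F\<close>; none does.
\<close>

lemma descending_bound:
  assumes F: "prime_filter F" and n: "chain_identity n L" "n \<ge> 1"
    and s: "descending F x k s" and x: "x \<notin> F"
  shows "Suc k < n"
proof (rule ccontr)
  assume "\<not> Suc k < n"
  then have kn: "n \<le> Suc k" by simp
  have sF: "s j \<notin> F" if "j \<le> k" for j
  proof (cases j)
    case 0
    then show ?thesis using s x by (simp add: descending_def)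
  next
    case (Suc i)
    then show ?thesis using s that F imp_mem_of_mem[OF F, of "s j" "s i"]
      by (auto simp: descending_def)
  qed
  define y where "y i = s (i - 1)" for i
  have y: "\<forall>i \<in> {1..n}. y i \<in> carrier L" using s kn by (auto simp: y_def descending_def)
  let ?ys = "map y [1..<n + 1] @ map (\<lambda>i. y i \<rightharpoonup> y (i + 1)) [1..<n]"
  have "joins L ?ys = \<one>" using n(1) y unfolding chain_identity_def by blast
  then have "joins L ?ys \<in> F" using F by (simp add: prime_filter_def lattice_filter_def)
  moreover have "set ?ys \<subseteq> carrier L" using y by (auto intro: closed)
  ultimately obtain z where z: "z \<in> set ?ys" "z \<in> F" using prime_filter_joins[OF F] by blast
  then have "z \<in> y ` {1..n} \<union> (\<lambda>i. y i \<rightharpoonup> y (i + 1)) ` {1..<n}" by auto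
  then consider i where "i \<in> {1..n}" "z = y i" | i where "i \<in> {1..<n}" "z = y i \<rightharpoonup> y (i + 1)"
    by blast
  then show False
  proof cases
    case 1
    moreover have "i - 1 \<le> k" using 1(1) kn by auto
    ultimately show False using sF[of "i - 1"] z(2) by (simp add: y_def)
  next
    case 2
    then obtain j where "i = Suc j" by (cases i) auto
    then show False using 2 s z(2) kn by (simp add: y_def descending_def)
  qed
qed

context
  fixes F n
  assumes F: "prime_filter F" and n: "chain_identity n L" "n \<ge> 1"
begin

lemma height_attained:
  assumes "x \<in> carrier L" "x \<notin> F"
  shows "\<exists>s. descending F x (height F x) s"
  unfolding height_def
proof (rule GreatestI_nat)
  show "\<exists>s. descending F x 0 s" using assms by (auto simp: descending_def)
  show "k \<le> n" if "\<exists>s. descending F x k s" for k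
    using that descending_bound[OF F n] assms by fastforce
qed

lemma le_height:
  assumes "descending F x k s" "x \<notin> F"
  shows "k \<le> height F x"
  unfolding height_def
proof (rule Greatest_le_nat)
  show "\<exists>s. descending F x k s" using assms by blast
  show "k \<le> n" if "\<exists>s. descending F x k s" for k
    using that descending_bound[OF F n] assms by fastforce
qed

lemma height_bound: "\<lbrakk>x \<in> carrier L; x \<notin> F\<rbrakk> \<Longrightarrow> Suc (height F x) < n"
  using height_attained descending_bound[OF F n] by blast

lemma height_mono:
  assumes c: "x \<in> carrier L" "y \<in> carrier L" and "y \<notin> F" and xy: "x \<rightharpoonup> y \<in> F" and x: "x \<notin> F"
  shows "height F x \<le> height F y"
proof -
  obtain s where s: "descending F x (height F x) s" using height_attained c x by blast
  have "descending F y (height F x) (s(0 := y))"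
    using s c imp_mem_trans[OF F xy] by (auto simp: descending_def)
  then show ?thesis using le_height assms(3) by blast
qed

lemma height_strict_mono:
  assumes c: "x \<in> carrier L" "y \<in> carrier L" and "y \<notin> F" and yx: "y \<rightharpoonup> x \<notin> F"
  shows "height F x < height F y"
proof -
  have "x \<notin> F" using yx c imp_mem_of_mem[OF F] by blast
  then obtain s where s: "descending F x (height F x) s" using height_attained c by blast
  have "descending F y (Suc (height F x)) (case_nat y s)"
    using s c yx by (auto simp: descending_def split: nat.split)
  then show ?thesis using le_height assms(3) by fastforce
qed

lemma height_zero: "height F \<zero> = 0"
proof -
  have "\<zero> \<notin> F" using F by (simp add: prime_filter_def)
  then obtain s where s: "descending F \<zero> (height F \<zero>) s" using height_attained zero_closed by blast
  show ?thesis
  proof (rule ccontr)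
    assume "height F \<zero> \<noteq> 0"
    then have "\<zero> \<rightharpoonup> s (Suc 0) \<notin> F" "s (Suc 0) \<in> carrier L"
      using s by (auto simp: descending_def)
    then show False using imp_mem_of_le[OF F] zero_le zero_closed by blast
  qed
qed

text \<open>
  Elements of \<open>F\<close> get the top rank \<open>n - 1\<close> regardless of the size of the quotient, because a
  homomorphism must send them to \<open>\<one>\<close>.
\<close>

lemma ex_rank:
  obtains R where "\<And>x. x \<in> carrier L \<Longrightarrow> R x < n"
    "\<And>x y. \<lbrakk>x \<in> carrier L; y \<in> carrier L\<rbrakk> \<Longrightarrow> R x \<le> R y \<longleftrightarrow> x \<rightharpoonup> y \<in> F"
    "R \<zero> = 0" "R \<one> = n - 1"
proof
  define R where "R x = (if x \<in> F then n - 1 else height F x)" for x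
  have bound: "R x < n \<and> (x \<notin> F \<longrightarrow> R x < n - 1)" if "x \<in> carrier L" for x
    using height_bound[OF that] n by (auto simp: R_def)
  show "R x < n" if "x \<in> carrier L" for x using bound that by blast
  show "R x \<le> R y \<longleftrightarrow> x \<rightharpoonup> y \<in> F" if c: "x \<in> carrier L" "y \<in> carrier L" for x y
  proof
    assume xy: "x \<rightharpoonup> y \<in> F"
    show "R x \<le> R y"
    proof (cases "y \<in> F")
      case True
      then show ?thesis using bound[OF c(1)] by (auto simp: R_def)
    next
      case False
      \<comment> \<open>Modus ponens: \<open>x \<sqinter> (x \<rightharpoonup> y) \<sqsubseteq> y\<close>.\<close>
      have "x \<notin> F"
      proof
        assume "x \<in> F"
        then have "x \<sqinter> (x \<rightharpoonup> y) \<in> F" using F xy by (simp add: prime_filter_def lattice_filter_def)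
        then have "y \<in> F" using c F mem_filter_mono by (simp add: meet_imp meet_le2)
        then show False using False by simp
      qed
      then show ?thesis using height_mono[OF c False xy] False by (simp add: R_def)
    qed
  next
    assume le: "R x \<le> R y"
    show "x \<rightharpoonup> y \<in> F"
    proof (rule ccontr)
      assume no: "x \<rightharpoonup> y \<notin> F"
      then have y: "y \<notin> F" using c imp_mem_of_mem[OF F] by blast
      show False
      proof (cases "x \<in> F")
        case True
        then show False using le bound[OF c(2)] y by (simp add: R_def)
      next
        case False
        then show False using le y height_strict_mono[OF c(2,1) False no] by (simp add: R_def)
      qed
    qed
  qed
  show "R \<zero> = 0" using F by (simp add: R_def height_zero prime_filter_def)
  show "R \<one> = n - 1" using F by (simp add: R_def prime_filter_def lattice_filter_def)
qed

end

end

lemma (in dually_Stone_Heyting_chain) ex_enumeration: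
  assumes n: "card (carrier L) = n" "n \<ge> 1"
  obtains e where "\<And>i. i < n \<Longrightarrow> e i \<in> carrier L"
    "\<And>i j. \<lbrakk>i < n; j < n\<rbrakk> \<Longrightarrow> e i \<sqsubseteq> e j \<longleftrightarrow> i \<le> j"
    "e 0 = \<zero>" "e (n - 1) = \<one>"
proof
  let ?A = "carrier L"
  have fin: "finite ?A" using n by (metis card.infinite not_one_le_zero)
  \<comment> \<open>Counting the elements strictly below ranks the chain by \<open>0, \<dots>, n - 1\<close>.\<close>
  define below where "below d = {c \<in> ?A. c \<sqsubseteq> d \<and> c \<noteq> d}" for d
  define g where "g d = card (below d)" for d
  define e where "e = inv_into ?A g"
  have finb: "finite (below d)" for d using fin by (simp add: below_def)
  have strict: "g c < g d" if "c \<sqsubseteq> d" "c \<noteq> d" "c \<in> ?A" "d \<in> ?A" for c d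
    unfolding g_def
  proof (rule psubset_card_mono[OF finb])
    have "below c \<subseteq> below d"
      using that le_trans le_antisym by (fastforce simp: below_def)
    moreover have "c \<in> below d" "c \<notin> below c" using that by (simp_all add: below_def)
    ultimately show "below c \<subset> below d" by blast
  qed
  have g_le: "g c \<le> g d \<longleftrightarrow> c \<sqsubseteq> d" if "c \<in> ?A" "d \<in> ?A" for c d
    using chain[OF that] strict[of c d] strict[of d c] that le_refl by (metis leD less_imp_le order_refl)
  have inj: "inj_on g ?A"
    using g_le le_antisym by (intro inj_onI) (metis order_refl)
  have "g d < n" if "d \<in> ?A" for d
    unfolding g_def n(1)[symmetric]
    by (rule psubset_card_mono[OF fin]) (use that in \<open>auto simp: below_def\<close>)
  then have "g ` ?A \<subseteq> {..<n}" by auto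
  moreover have "card (g ` ?A) = n" using inj n by (simp add: card_image)
  ultimately have img: "g ` ?A = {..<n}" by (intro card_subset_eq) auto
  have e: "e i \<in> ?A" "g (e i) = i" if "i < n" for i
    using that img unfolding e_def by (auto intro: inv_into_into f_inv_into_f)
  then show "e i \<in> ?A" if "i < n" for i using that by blast
  show "e i \<sqsubseteq> e j \<longleftrightarrow> i \<le> j" if "i < n" "j < n" for i j
    using g_le[of "e i" "e j"] e that by simp
  have "below \<zero> = {}" by (auto simp: below_def le_zero_iff)
  then have "g \<zero> = 0" by (simp add: g_def)
  then show "e 0 = \<zero>" using inv_into_f_f[OF inj zero_closed] by (simp add: e_def)
  have "below \<one> = ?A - {\<one>}" by (auto simp: below_def le_one)
  then have "g \<one> = n - 1" using n fin by (simp add: g_def one_closed)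
  then show "e (n - 1) = \<one>" using inv_into_f_f[OF inj one_closed] by (simp add: e_def)
qed

section \<open>Separating homomorphisms and the generated variety\<close>

lemma (in JIDL1_em) ex_separating_hom:
  fixes D :: "'c dqd_algebra"
  assumes n: "chain_identity n L" "n \<ge> 1"
    and D: "dually_Stone_Heyting_chain D" "card (carrier D) = n"
    and ab: "a \<in> carrier L" "b \<in> carrier L" "a \<noteq> b"
  shows "\<exists>h. dqd_hom (carrier L) L D h \<and> h a \<noteq> h b"
proof -
  interpret D: dually_Stone_Heyting_chain D by fact
  define c where "c = (a \<rightharpoonup> b) \<sqinter> (b \<rightharpoonup> a)"
  have c: "c \<in> carrier L" using ab by (simp add: c_def closed)
  have "c \<noteq> \<one>"
  proof
    assume "c = \<one>"
    then have "\<one> \<sqsubseteq> a \<rightharpoonup> b" "\<one> \<sqsubseteq> b \<rightharpoonup> a"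
      using meet_le1[of "a \<rightharpoonup> b" "b \<rightharpoonup> a"] meet_le2[of "a \<rightharpoonup> b" "b \<rightharpoonup> a"] ab
      by (simp_all add: closed c_def)
    then show False using ab le_antisym by (simp add: one_le_iff imp_eq_one_iff closed)
  qed
  then have "\<sim> (\<sim> c) \<noteq> \<one>" using dneg_dneg_le[OF c] c one_le_iff by metis
  then obtain P where P: "prime_filter P" "\<sim> (\<sim> c) \<notin> P"
    using ex_prime_filter[of "\<sim> (\<sim> c)"] c by (auto simp: dneg_closed)
  define F where "F = core P"
  have F: "prime_filter F" unfolding F_def using P(1) by (rule prime_filter_core)
  have "c \<notin> F" using P by (simp add: F_def core_def)
  then have sep: "\<not> (a \<rightharpoonup> b \<in> F \<and> b \<rightharpoonup> a \<in> F)"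
    using F by (auto simp: c_def prime_filter_def lattice_filter_def)
  obtain R where R: "\<And>x. x \<in> carrier L \<Longrightarrow> R x < n"
    "\<And>x y. \<lbrakk>x \<in> carrier L; y \<in> carrier L\<rbrakk> \<Longrightarrow> R x \<le> R y \<longleftrightarrow> x \<rightharpoonup> y \<in> F"
    "R \<zero> = 0" "R \<one> = n - 1"
    using ex_rank[OF F n] by blast
  obtain e where e: "\<And>i. i < n \<Longrightarrow> e i \<in> carrier D"
    "\<And>i j. \<lbrakk>i < n; j < n\<rbrakk> \<Longrightarrow> lat_le D (e i) (e j) \<longleftrightarrow> i \<le> j"
    "e 0 = \<zero>\<^bsub>D\<^esub>" "e (n - 1) = \<one>\<^bsub>D\<^esub>"
    using D.ex_enumeration[OF D(2) n(2)] by blast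
  define h where "h x = e (R x)" for x
  have emb: "lat_le D (h x) (h y) \<longleftrightarrow> x \<rightharpoonup> y \<in> core P"
    if "x \<in> carrier L" "y \<in> carrier L" for x y
    using that R e by (simp add: h_def F_def)
  have "dqd_hom (carrier L) L D h"
    by (rule hom_of_quotient_embedding[OF D(1) P(1)]) (simp_all add: emb, simp_all add: h_def R e(1-3) e(4)[simplified])
  moreover have "h a \<noteq> h b"
  proof
    assume "h a = h b"
    then have "lat_le D (h a) (h b)" "lat_le D (h b) (h a)"
      using ab R e D.le_refl by (simp_all add: h_def)
    then show False using sep emb ab by (simp add: F_def)
  qed
  ultimately show ?thesis by blast
qed

text \<open>
  The index set consists of all homomorphisms into \<open>C\<close>, and \<open>A\<close> is recovered from its image in the
  power by inverting the evaluation embedding.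
\<close>

lemma (in DQD) HSP_over_if_separated:
  fixes C :: "'c dqd_algebra"
  assumes sep: "\<And>a b. \<lbrakk>a \<in> carrier L; b \<in> carrier L; a \<noteq> b\<rbrakk>
      \<Longrightarrow> \<exists>h. dqd_hom (carrier L) L C h \<and> h a \<noteq> h b"
  shows "HSP_over {h. dqd_hom (carrier L) L C h} C L"
proof -
  define I where "I = {h. dqd_hom (carrier L) L C h}"
  define ev where "ev a = (\<lambda>f\<in>I. f a)" for a
  let ?B = "power_algebra I C"
  have I: "f (x \<squnion> y) = f x \<squnion>\<^bsub>C\<^esub> f y" "f (x \<sqinter> y) = f x \<sqinter>\<^bsub>C\<^esub> f y" "f (x \<rightharpoonup> y) = f x \<rightharpoonup>\<^bsub>C\<^esub> f y"
    "f (\<sim> x) = \<sim>\<^bsub>C\<^esub> (f x)" "f \<zero> = \<zero>\<^bsub>C\<^esub>" "f \<one> = \<one>\<^bsub>C\<^esub>" "f x \<in> carrier C"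
    if "f \<in> I" "x \<in> carrier L" "y \<in> carrier L" for f x y
    using that by (auto simp: I_def dqd_hom_def)
  have ev: "ev x \<squnion>\<^bsub>?B\<^esub> ev y = ev (x \<squnion> y)" "ev x \<sqinter>\<^bsub>?B\<^esub> ev y = ev (x \<sqinter> y)"
    "ev x \<rightharpoonup>\<^bsub>?B\<^esub> ev y = ev (x \<rightharpoonup> y)" "\<sim>\<^bsub>?B\<^esub> (ev x) = ev (\<sim> x)"
    "\<zero>\<^bsub>?B\<^esub> = ev \<zero>" "\<one>\<^bsub>?B\<^esub> = ev \<one>" "ev x \<in> carrier ?B"
    if "x \<in> carrier L" "y \<in> carrier L" for x y
    using I[OF _ that] by (auto simp: ev_def power_algebra_def fun_eq_iff restrict_def)
  note ev0 = ev(5,6)[OF zero_closed zero_closed] and evn = ev(4)[OF _ zero_closed]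
    and evc = ev(7)[OF _ zero_closed]
  have inj: "inj_on ev (carrier L)"
  proof (intro inj_onI, rule ccontr)
    fix a b assume ab: "a \<in> carrier L" "b \<in> carrier L" "ev a = ev b" "a \<noteq> b"
    then obtain h where "h \<in> I" "h a \<noteq> h b" using sep by (auto simp: I_def)
    then show False using fun_cong[OF ab(3), of h] by (simp add: ev_def)
  qed
  define k where "k = inv_into (carrier L) ev"
  have k: "k (ev x) = x" if "x \<in> carrier L" for x using inj that by (simp add: k_def)
  have "dqd_subuniverse (ev ` carrier L) ?B"
    unfolding dqd_subuniverse_def
    by (auto simp: ev(1-3) ev0 evn evc intro!: imageI closed dneg_closed)
  moreover have "dqd_hom (ev ` carrier L) ?B L k"
    unfolding dqd_hom_def by (auto simp: ev(1-3) ev0 evn k closed dneg_closed)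
  moreover have "k ` ev ` carrier L = carrier L" using k by (force simp: image_iff)
  ultimately show ?thesis unfolding HSP_over_def I_def[symmetric] by blast
qed

theorem corollary7p5:
  fixes n :: nat and C :: "'c dqd_algebra"
  assumes "n \<ge> 2"
    and "dually_Stone_Heyting_chain C" and "card (carrier C) = n"
  shows "(variety_generated C :: 'a dqd_algebra set) =
    {A. JIDL1 A
      \<and> (\<forall>x \<in> carrier A. x \<squnion>\<^bsub>A\<^esub> \<sim>\<^bsub>A\<^esub> x = \<one>\<^bsub>A\<^esub>)
      \<and> (\<forall>x :: nat \<Rightarrow> 'a. (\<forall>i \<in> {1..n}. x i \<in> carrier A) \<longrightarrow>
          joins A (map x [1..<n + 1] @ map (\<lambda>i. x i \<rightharpoonup>\<^bsub>A\<^esub> x (i + 1)) [1..<n]) = \<one>\<^bsub>A\<^esub>)}"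
proof -
  interpret C: dually_Stone_Heyting_chain C by fact
  have n: "n \<ge> 1" using assms(1) by simp
  have "A \<in> variety_generated C \<longleftrightarrow> JIDL1_em A \<and> chain_identity n A" for A :: "'a dqd_algebra"
  proof
    assume "A \<in> variety_generated C"
    then obtain I :: "('a \<Rightarrow> 'c) set" and S h where S: "dqd_subuniverse S (power_algebra I C)"
      and h: "dqd_hom S (power_algebra I C) A h" "h ` S = carrier A"
      by (auto simp: variety_generated_def HSP_over_def)
    have "JIDL1_em (power_algebra I C)" "chain_identity n (power_algebra I C)"
      using C.JIDL1_em C.chain_identity[OF assms(3) n]
      by (simp_all add: JIDL1_em_power chain_identity_power)
    then show "JIDL1_em A \<and> chain_identity n A"
      using JIDL1_em_image[OF _ S h] chain_identity_image[OF _ S h] by simp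
  next
    assume A: "JIDL1_em A \<and> chain_identity n A"
    then interpret A: JIDL1_em A by simp
    have "HSP_over {h. dqd_hom (carrier A) A C h} C A"
      using A n assms by (intro A.HSP_over_if_separated A.ex_separating_hom) auto
    then show "A \<in> variety_generated C" by (rule HSP_over_imp_variety)
  qed
  then show ?thesis
    by (auto simp: JIDL1_em_def JIDL1_em_axioms_def chain_identity_def)
qed

end
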